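(* Let $p\ge 2$ be an integer, let $\mathrm{BS}(1,p)=\langle a,t\mid tat^{-1}=a^p\rangle$ and $X=\{a^{\pm1},t^{\pm1}\}$. The normal form for $(\mathrm{BS}(1,p),X)$ consisting of the words \begin{itemize} \item $t^i$, \item $(a^{\eta_0})^{t^{\alpha_0}}(a^{\eta_1})^{t^{\alpha_1}}\cdots(a^{\eta_k})^{t^{\alpha_k}}t^i$, \item $(a^{-\eta_0})^{t^{\alpha_0}}(a^{-\eta_1})^{t^{\alpha_1}}\cdots(a^{-\eta_k})^{t^{\alpha_k}}t^i$, \end{itemize} where $i,k\in\mathbb{Z}$, $k\ge 0$, the $\eta_j$ are integers with $0<\eta_j<p$, the $\alpha_j$ are integers with $\alpha_0>\alpha_1>\cdots>\alpha_k$, and $x^y=y^{-1}xy$, can be computed in logspace.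
   Context: Here $(a^{\eta})^{t^{\alpha}}$ stands for the word $t^{-\alpha}a^{\eta}t^{\alpha}$. A normal form for a group $G$ with finite symmetric generating set $X$ is a subset $L\subseteq X^*$ mapped bijectively onto $G$ by the map sending a word $w$ to the element $\overline{w}$ it represents. Saying that the normal form $L$ can be computed in logspace means that the function $f:X^*\to X^*$ sending $w$ to the unique word $f(w)\in L$ with $\overline{f(w)}=\overline{w}$ is logspace computable. A deterministic logspace transducer is a deterministic machine with a finite state control and three tapes: a read-only input tape storing the input word; a read-write work tape restricted to at most $c\log n$ squares, where $n$ is the length of the input word and $c$ is a fixed constant; and a write-only output tape written from left to right. In each transition it may modify the work tape, change state, move the input read-head, and write at most a fixed constant number of letters to the output tape. A function $f:X^*\to X^*$ is logspace computable if some deterministic logspace transducer outputs $f(w)$ on every input $w\in X^*$ ($X^*$ is the set of finite words over $X$, including the empty word). *)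

theory Defs
  imports Complex_Main "HOL-Algebra.Group"
begin

section \<open>Group presentations\<close>

text \<open>
  The letter \<open>(x, True)\<close> stands for the generator \<open>x\<close> and \<open>(x, False)\<close> for its formal inverse.
\<close>

type_synonym 'x letter = "'x \<times> bool"
type_synonym 'x word = "'x letter list"

definition pow_word :: "'x \<Rightarrow> int \<Rightarrow> 'x word" where
  "pow_word x i = replicate (nat \<bar>i\<bar>) (x, 0 \<le> i)"

text \<open>
  \<open>pres_eq R u v\<close>: the words \<open>u\<close> and \<open>v\<close> are equal in the group generated by all \<open>x :: 'x\<close> subject to
  the relations \<open>l = r\<close> for \<open>(l, r) \<in> R\<close>. It is the congruence on words generated by free cancellation
  and the relations. The group is its quotient; \<open>presented_group_universal\<close> below gives the
  universal property.
\<close>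

inductive pres_eq :: "('x word \<times> 'x word) set \<Rightarrow> 'x word \<Rightarrow> 'x word \<Rightarrow> bool"
  for R :: "('x word \<times> 'x word) set" where
  refl: "pres_eq R u u"
| sym: "pres_eq R u v \<Longrightarrow> pres_eq R v u"
| trans: "pres_eq R u v \<Longrightarrow> pres_eq R v w \<Longrightarrow> pres_eq R u w"
| cancel: "pres_eq R (u @ [(x, b), (x, \<not> b)] @ v) (u @ v)"
| relation: "(l, r) \<in> R \<Longrightarrow> pres_eq R (u @ l @ v) (u @ r @ v)"

definition word_class :: "('x word \<times> 'x word) set \<Rightarrow> 'x word \<Rightarrow> 'x word set" where
  "word_class R u = {v. pres_eq R u v}"

definition presented_group :: "('x word \<times> 'x word) set \<Rightarrow> 'x word set monoid" where
  "presented_group R =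
    \<lparr>carrier = range (word_class R),
     mult = (\<lambda>A B. \<Union>u\<in>A. \<Union>v\<in>B. word_class R (u @ v)),
     one = word_class R []\<rparr>"

definition letter_elt :: "('x word \<times> 'x word) set \<Rightarrow> 'x letter \<Rightarrow> 'x word set" where
  "letter_elt R x = word_class R [x]"


section \<open>Words over a generating set and normal forms\<close>

text \<open>
  An alphabet \<open>'x\<close> is interpreted in the group \<open>G\<close> by \<open>\<phi>\<close>.
\<close>

definition word_elt :: "('g, 'm) monoid_scheme \<Rightarrow> ('x \<Rightarrow> 'g) \<Rightarrow> 'x list \<Rightarrow> 'g" where
  "word_elt G \<phi> w = foldr (\<lambda>x g. \<phi> x \<otimes>\<^bsub>G\<^esub> g) w \<one>\<^bsub>G\<^esub>"

definition normal_form :: "('g, 'm) monoid_scheme \<Rightarrow> ('x \<Rightarrow> 'g) \<Rightarrow> 'x list set \<Rightarrow> bool" where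
  "normal_form G \<phi> L \<longleftrightarrow> bij_betw (word_elt G \<phi>) L (carrier G)"

definition normal_form_map ::
    "('g, 'm) monoid_scheme \<Rightarrow> ('x \<Rightarrow> 'g) \<Rightarrow> 'x list set \<Rightarrow> 'x list \<Rightarrow> 'x list" where
  "normal_form_map G \<phi> L w = (THE v. v \<in> L \<and> word_elt G \<phi> v = word_elt G \<phi> w)"


section \<open>Facts about presented groups\<close>

lemma pres_eq_context:
  assumes "pres_eq R u v"
  shows "pres_eq R (s @ u @ t) (s @ v @ t)"
  using assms
proof induction
  case (cancel u x b v)
  show ?case using pres_eq.cancel[of R "s @ u" x b "v @ t"] by simp
next
  case (relation l r u v)
  show ?case using pres_eq.relation[OF relation, of "s @ u" "v @ t"] by simp
qed (blast intro: pres_eq.intros)+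

lemma pres_eq_append:
  assumes "pres_eq R u u'" "pres_eq R v v'"
  shows "pres_eq R (u @ v) (u' @ v')"
  using pres_eq_context[OF assms(1), of "[]" v] pres_eq_context[OF assms(2), of u' "[]"]
  by (auto intro: pres_eq.trans)

lemma word_class_eq_iff: "word_class R u = word_class R v \<longleftrightarrow> pres_eq R u v"
  unfolding word_class_def by (blast intro: pres_eq.intros)

lemma presented_group_mult:
  "word_class R u \<otimes>\<^bsub>presented_group R\<^esub> word_class R v = word_class R (u @ v)"
  unfolding presented_group_def word_class_def
  by (auto intro: pres_eq.intros pres_eq_append)

lemma pres_eq_inverse: "pres_eq R (rev (map (\<lambda>(x, b). (x, \<not> b)) u) @ u) []"
proof (induction u)
  case (Cons y u)
  obtain x b where y: "y = (x, b)" by (cases y)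
  have "pres_eq R (rev (map (\<lambda>(x, b). (x, \<not> b)) u) @ [(x, \<not> b), (x, \<not> \<not> b)] @ u)
          (rev (map (\<lambda>(x, b). (x, \<not> b)) u) @ u)"
    by (rule pres_eq.cancel)
  then show ?case using Cons.IH y by (auto intro: pres_eq.trans)
qed (simp add: pres_eq.refl)

lemma group_presented_group: "group (presented_group R)"
proof (rule groupI)
  have carr: "carrier (presented_group R) = range (word_class R)"
    and one: "\<one>\<^bsub>presented_group R\<^esub> = word_class R []"
    by (simp_all add: presented_group_def)
  show "x \<otimes>\<^bsub>presented_group R\<^esub> y \<in> carrier (presented_group R)"
    if "x \<in> carrier (presented_group R)" "y \<in> carrier (presented_group R)" for x y
    using that by (auto simp: carr presented_group_mult)
  show "\<one>\<^bsub>presented_group R\<^esub> \<in> carrier (presented_group R)"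
    by (simp add: carr one)
  show "x \<otimes>\<^bsub>presented_group R\<^esub> y \<otimes>\<^bsub>presented_group R\<^esub> z =
      x \<otimes>\<^bsub>presented_group R\<^esub> (y \<otimes>\<^bsub>presented_group R\<^esub> z)"
    if "x \<in> carrier (presented_group R)" "y \<in> carrier (presented_group R)"
      "z \<in> carrier (presented_group R)" for x y z
    using that by (auto simp: carr presented_group_mult)
  show "\<one>\<^bsub>presented_group R\<^esub> \<otimes>\<^bsub>presented_group R\<^esub> x = x"
    if "x \<in> carrier (presented_group R)" for x
    using that by (auto simp: carr one presented_group_mult)
  show "\<exists>y\<in>carrier (presented_group R). y \<otimes>\<^bsub>presented_group R\<^esub> x = \<one>\<^bsub>presented_group R\<^esub>"
    if "x \<in> carrier (presented_group R)" for x
    using that pres_eq_inverse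
    by (fastforce simp: carr one presented_group_mult word_class_eq_iff)
qed

lemma word_elt_presented_group:
  "word_elt (presented_group R) (letter_elt R) w = word_class R w"
proof (induction w)
  case Nil
  then show ?case by (simp add: word_elt_def presented_group_def)
next
  case (Cons x w)
  then show ?case by (simp add: word_elt_def letter_elt_def presented_group_mult)
qed

lemma presented_group_universal:
  fixes H (structure) and h :: "'x \<Rightarrow> 'h"
  defines "\<phi> \<equiv> \<lambda>(x, b). if b then h x else inv (h x)"
  assumes H: "group H" and h: "\<And>x. h x \<in> carrier H"
    and R: "\<And>l r. (l, r) \<in> R \<Longrightarrow> word_elt H \<phi> l = word_elt H \<phi> r"
  shows "\<exists>f \<in> hom (presented_group R) H. \<forall>w. f (word_class R w) = word_elt H \<phi> w"
proof -
  interpret group H by fact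
  have \<phi>: "\<phi> y \<in> carrier H" for y using h by (auto simp: \<phi>_def split: prod.split)
  have closed: "word_elt H \<phi> w \<in> carrier H" for w
    by (induction w) (auto simp: word_elt_def \<phi>)
  have app: "word_elt H \<phi> (u @ v) = word_elt H \<phi> u \<otimes> word_elt H \<phi> v" for u v
  proof (induction u)
    case Nil
    then show ?case using closed[of v] by (simp add: word_elt_def)
  next
    case (Cons y u)
    then show ?case using closed[of u] closed[of v] \<phi>[of y]
      by (simp add: word_elt_def m_assoc)
  qed
  have two: "word_elt H \<phi> [(x, b), (x, \<not> b)] = \<one>" for x b
    using h[of x] by (auto simp: word_elt_def \<phi>_def)
  have eq: "word_elt H \<phi> u = word_elt H \<phi> v" if "pres_eq R u v" for u v
    using that
  proof induction
    case (cancel u x b v)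
    show ?case using two[of x b] closed by (simp only: app) simp
  next
    case (relation l r u v)
    then show ?case using R[of l r] by (simp add: app)
  qed auto
  define f where "f A = word_elt H \<phi> (SOME w. w \<in> A)" for A
  have f: "f (word_class R w) = word_elt H \<phi> w" for w
  proof -
    have "w \<in> word_class R w" by (simp add: word_class_def pres_eq.refl)
    then have "(SOME v. v \<in> word_class R w) \<in> word_class R w" by (rule someI)
    then show ?thesis using eq by (auto simp: f_def word_class_def)
  qed
  have "f \<in> hom (presented_group R) H"
  proof (rule homI)
    show "f x \<in> carrier H" if "x \<in> carrier (presented_group R)" for x
      using that f closed by (auto simp: presented_group_def)
    show "f (x \<otimes>\<^bsub>presented_group R\<^esub> y) = f x \<otimes> f y"
      if xy: "x \<in> carrier (presented_group R)" "y \<in> carrier (presented_group R)" for x y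
    proof -
      obtain u v where "x = word_class R u" "y = word_class R v"
        using xy by (auto simp: presented_group_def)
      then show ?thesis by (simp add: presented_group_mult f app)
    qed
  qed
  with f show ?thesis by blast
qed


section \<open>The groups \<open>BS(1,p)\<close>\<close>

datatype bs_gen = Gen_a | Gen_t

instance bs_gen :: finite
proof
  have "(UNIV :: bs_gen set) = {Gen_a, Gen_t}" using bs_gen.exhaust by auto
  then show "finite (UNIV :: bs_gen set)" by (metis finite.emptyI finite.insertI)
qed

definition bs_rel :: "int \<Rightarrow> (bs_gen word \<times> bs_gen word) set" where
  "bs_rel p = {(pow_word Gen_t 1 @ pow_word Gen_a 1 @ pow_word Gen_t (-1), pow_word Gen_a p)}"

abbreviation BS1 :: "int \<Rightarrow> bs_gen word set monoid" where
  "BS1 p \<equiv> presented_group (bs_rel p)"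

abbreviation bs_letter :: "int \<Rightarrow> bs_gen letter \<Rightarrow> bs_gen word set" where
  "bs_letter p \<equiv> letter_elt (bs_rel p)"

text \<open>The word \<open>t\<^sup>-\<^sup>\<alpha> a\<^sup>\<eta> t\<^sup>\<alpha>\<close>; no free reduction is performed here or below.\<close>

definition conj_word :: "int \<Rightarrow> int \<Rightarrow> bs_gen word" where
  "conj_word \<eta> \<alpha> = pow_word Gen_t (- \<alpha>) @ pow_word Gen_a \<eta> @ pow_word Gen_t \<alpha>"

definition bs_words :: "int \<Rightarrow> bs_gen word set" where
  "bs_words p =
     {pow_word Gen_t i | i. True} \<union>
     {concat (map (\<lambda>j. conj_word (\<eta> j) (\<alpha> j)) [0..<k+1]) @ pow_word Gen_t i | \<eta> \<alpha> k i.
        (\<forall>j\<le>k. 0 < \<eta> j \<and> \<eta> j < p) \<and> (\<forall>j<k. \<alpha> j > \<alpha> (j+1))} \<union>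
     {concat (map (\<lambda>j. conj_word (- \<eta> j) (\<alpha> j)) [0..<k+1]) @ pow_word Gen_t i | \<eta> \<alpha> k i.
        (\<forall>j\<le>k. 0 < \<eta> j \<and> \<eta> j < p) \<and> (\<forall>j<k. \<alpha> j > \<alpha> (j+1))}"


section \<open>Deterministic logspace transducers\<close>

text \<open>
  The input \<open>w\<close> occupies squares \<open>1, \<dots>, length w\<close> of the input tape, between two end markers that
  the input head never passes. The work tape is infinite to the right only. On both tapes a move
  off the tape leaves the head where it is. A transition yields the new state, the symbol written
  on the work tape, the moves of the input and work heads, and the letters appended to the output
  tape. The value \<open>None\<close> means that the machine halts.
\<close>

datatype 'x input_symbol = Left_End | Letter 'x | Right_End

datatype move = Move_Left | Stay | Move_Right

record ('q, 's, 'x) transducer =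
  states :: "'q set"
  initial :: 'q
  work_alphabet :: "'s set"
  blank :: 's
  transition :: "'q \<Rightarrow> 'x input_symbol \<Rightarrow> 's \<Rightarrow> ('q \<times> 's \<times> move \<times> move \<times> 'x list) option"

definition wf_transducer :: "('q, 's, 'x) transducer \<Rightarrow> bool" where
  "wf_transducer M \<longleftrightarrow>
     finite (states M) \<and> initial M \<in> states M \<and>
     finite (work_alphabet M) \<and> blank M \<in> work_alphabet M \<and>
     (\<forall>q\<in>states M. \<forall>x. \<forall>s\<in>work_alphabet M. \<forall>q' s' d e z.
        transition M q x s = Some (q', s', d, e, z) \<longrightarrow> q' \<in> states M \<and> s' \<in> work_alphabet M) \<and>
     (\<exists>b. \<forall>q\<in>states M. \<forall>x. \<forall>s\<in>work_alphabet M. \<forall>q' s' d e z.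
        transition M q x s = Some (q', s', d, e, z) \<longrightarrow> length z \<le> b)"

record ('q, 's, 'x) config =
  state :: 'q
  input_pos :: nat
  work_tape :: "nat \<Rightarrow> 's"
  work_pos :: nat
  out_tape :: "'x list"

definition input_at :: "'x list \<Rightarrow> nat \<Rightarrow> 'x input_symbol" where
  "input_at w i =
     (if i = 0 then Left_End else if i \<le> length w then Letter (w ! (i - 1)) else Right_End)"

fun move_head :: "move \<Rightarrow> nat \<Rightarrow> nat" where
  "move_head Move_Left i = i - 1"
| "move_head Stay i = i"
| "move_head Move_Right i = i + 1"

definition init_config :: "('q, 's, 'x) transducer \<Rightarrow> ('q, 's, 'x) config" where
  "init_config M =
     \<lparr>state = initial M, input_pos = 0, work_tape = (\<lambda>_. blank M), work_pos = 0, out_tape = []\<rparr>"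

definition step ::
    "('q, 's, 'x) transducer \<Rightarrow> 'x list \<Rightarrow> ('q, 's, 'x) config \<Rightarrow> ('q, 's, 'x) config option" where
  "step M w c =
     (case transition M (state c) (input_at w (input_pos c)) (work_tape c (work_pos c)) of
        None \<Rightarrow> None
      | Some (q, s, d, e, z) \<Rightarrow> Some
          \<lparr>state = q,
           input_pos = min (length w + 1) (move_head d (input_pos c)),
           work_tape = (work_tape c)(work_pos c := s),
           work_pos = move_head e (work_pos c),
           out_tape = out_tape c @ z\<rparr>)"

definition reachable :: "('q, 's, 'x) transducer \<Rightarrow> 'x list \<Rightarrow> ('q, 's, 'x) config \<Rightarrow> bool" where
  "reachable M w = (\<lambda>c d. step M w c = Some d)\<^sup>*\<^sup>* (init_config M)"

definition outputs :: "('q, 's, 'x) transducer \<Rightarrow> 'x list \<Rightarrow> 'x list \<Rightarrow> bool" where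
  "outputs M w v \<longleftrightarrow> (\<exists>c. reachable M w c \<and> step M w c = None \<and> out_tape c = v)"

text \<open>
  The squares of the work tape that are visited form an initial segment, so \<open>work_pos c + 1\<close>
  bounds their number. As \<open>log n\<close> is not positive for \<open>n < 2\<close>, those lengths are given the
  bound for \<open>n = 2\<close>.
\<close>

definition logspace_transducer :: "('q, 's, 'x) transducer \<Rightarrow> bool" where
  "logspace_transducer M \<longleftrightarrow> wf_transducer M \<and>
     (\<exists>C::real. \<forall>w c. reachable M w c \<longrightarrow>
        real (work_pos c + 1) \<le> C * log 2 (real (max 2 (length w))))"

text \<open>
  States and work symbols are natural numbers, without loss of generality because both sets are
  finite.
\<close>

definition logspace_computable :: "('x::finite list \<Rightarrow> 'x list) \<Rightarrow> bool" where
  "logspace_computable f \<longleftrightarrow>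
     (\<exists>M :: (nat, nat, 'x) transducer. logspace_transducer M \<and> (\<forall>w. outputs M w (f w)))"

end

theory Submission
  imports Defs
begin

text \<open>
  The group \<open>BS(1,p)\<close> acts faithfully on the line, \<open>a\<close> as \<open>x \<mapsto> x + 1\<close> and \<open>t\<close> as \<open>x \<mapsto> p x\<close>. A word
  \<open>w\<close> of length \<open>n\<close> acts as \<open>x \<mapsto> c + p\<^sup>e x\<close>, where \<open>e\<close> is its exponent sum in \<open>t\<close> and \<open>c\<close> is the sum of
  \<open>\<plusminus>p\<^sup>j\<close> over the letters \<open>a\<^sup>\<plusminus>\<^sup>1\<close> of \<open>w\<close>, \<open>j\<close> being the exponent sum in \<open>t\<close> before that letter. The word
  \<open>t\<^sup>-\<^sup>\<alpha> a\<^sup>\<eta> t\<^sup>\<alpha>\<close> is the translation by \<open>\<eta> p\<^sup>-\<^sup>\<alpha>\<close>, so that the proposed words list the nonzero base \<open>p\<close>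
  digits of \<open>\<bar>c\<bar>\<close>, least significant first, with the sign of \<open>c\<close>, followed by \<open>t\<^sup>e\<close>. Uniqueness of base
  \<open>p\<close> expansions makes this a normal form (lemmas \<open>affine_pres_eq\<close>, \<open>sparse_digits_unique\<close>,
  \<open>normal_formI\<close>).

  All positions \<open>j\<close> lie in \<open>[-n, n]\<close> and \<open>\<bar>c\<bar> < p\<^sup>2\<^sup>n\<close>, so the digits live at the \<open>3 n\<close> places
  \<open>-n, \<dots>, 2 n - 1\<close>. A single carry, of absolute value at most \<open>n\<close>, suffices to produce them from the
  lowest place upwards: at each place add the signed number of letters \<open>a\<^sup>\<plusminus>\<^sup>1\<close> that occur there,
  which one more scan of the input determines, and divide by \<open>p\<close> with remainder
  (\<open>carry_to_Suc\<close>, \<open>digit_at_carry\<close>). The carry that remains above the top place is \<open>0\<close> or \<open>-1\<close> and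
  reveals the sign of \<open>c\<close> (\<open>carry_to_top\<close>). A first silent pass therefore finds the sign, and a second
  pass, with all letters \<open>a\<^sup>\<plusminus>\<^sup>1\<close> negated if \<open>c < 0\<close>, prints the digits of \<open>\<bar>c\<bar>\<close>. Everything that has to be
  remembered is a constant number of counters with values \<open>O(n)\<close>, hence \<open>O(log n)\<close> bits.

  To avoid constructing a transition table by hand, the machine is written in a small structured
  language whose programs compile to transducers (\<open>logspace_computable_program\<close>); binary counters
  are built in that language (\<open>wp_inc\<close>, \<open>wp_compare\<close>, \<open>wp_divmod\<close>), and the algorithm is verified on
  the level of counter values (\<open>wp_scan\<close>, \<open>wp_pass\<close>, \<open>wp_bs_program\<close>).
\<close>

section \<open>Structured programs for transducers\<close>

text \<open>
  One \<open>Do\<close> is one move of the machine. Besides the tapes it can use a register of type \<open>'r\<close>, which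
  becomes part of the finite control. The memory on which a program runs is a configuration whose
  state is the register.
\<close>

datatype ('r, 's, 'x) prog =
  Do "'r \<Rightarrow> 'x input_symbol \<Rightarrow> 's \<Rightarrow> 'r \<times> 's \<times> move \<times> move \<times> 'x list"
| Seq "('r, 's, 'x) prog" "('r, 's, 'x) prog" (infixr \<open>;;\<close> 60)
| Cond "'r \<Rightarrow> 'x input_symbol \<Rightarrow> 's \<Rightarrow> bool" "('r, 's, 'x) prog" "('r, 's, 'x) prog"
| While "'r \<Rightarrow> 'x input_symbol \<Rightarrow> 's \<Rightarrow> bool" "('r, 's, 'x) prog"

definition read_input :: "'x list \<Rightarrow> ('r, 's, 'x) config \<Rightarrow> 'x input_symbol" where
  "read_input w m = input_at w (input_pos m)"

definition read_work :: "('r, 's, 'x) config \<Rightarrow> 's" where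
  "read_work m = work_tape m (work_pos m)"

definition holds ::
    "'x list \<Rightarrow> ('r \<Rightarrow> 'x input_symbol \<Rightarrow> 's \<Rightarrow> bool) \<Rightarrow> ('r, 's, 'x) config \<Rightarrow> bool" where
  "holds w b m = b (state m) (read_input w m) (read_work m)"

definition act ::
    "'x list \<Rightarrow> ('r \<Rightarrow> 'x input_symbol \<Rightarrow> 's \<Rightarrow> 'r \<times> 's \<times> move \<times> move \<times> 'x list) \<Rightarrow>
     ('r, 's, 'x) config \<Rightarrow> ('r, 's, 'x) config" where
  "act w f m =
     (case f (state m) (read_input w m) (read_work m) of (r, s, d, e, z) \<Rightarrow>
       \<lparr>state = r,
        input_pos = min (length w + 1) (move_head d (input_pos m)),
        work_tape = (work_tape m)(work_pos m := s),
        work_pos = move_head e (work_pos m),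
        out_tape = out_tape m @ z\<rparr>)"

text \<open>
  The bound \<open>B\<close> on the work head is part of the big-step semantics, so that a terminating execution
  certifies the space of all configurations it passes through.
\<close>

inductive exec :: "'x list \<Rightarrow> nat \<Rightarrow> ('r, 's, 'x) prog \<Rightarrow> ('r, 's, 'x) config \<Rightarrow>
    ('r, 's, 'x) config \<Rightarrow> bool" for w B where
  exec_Do: "work_pos m < B \<Longrightarrow> exec w B (Do f) m (act w f m)"
| exec_Seq: "exec w B p m m' \<Longrightarrow> exec w B q m' m'' \<Longrightarrow> exec w B (p ;; q) m m''"
| exec_Cond_True: "holds w b m \<Longrightarrow> exec w B p m m' \<Longrightarrow> exec w B (Cond b p q) m m'"
| exec_Cond_False: "\<not> holds w b m \<Longrightarrow> exec w B q m m' \<Longrightarrow> exec w B (Cond b p q) m m'"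
| exec_While_True: "holds w b m \<Longrightarrow> exec w B p m m' \<Longrightarrow> exec w B (While b p) m' m'' \<Longrightarrow>
    exec w B (While b p) m m''"
| exec_While_False: "\<not> holds w b m \<Longrightarrow> work_pos m < B \<Longrightarrow> exec w B (While b p) m m"

lemma exec_work_pos: "exec w B p m m' \<Longrightarrow> work_pos m < B"
  by (induction rule: exec.induct) auto

lemma exec_input_pos:
  "exec w B p m m' \<Longrightarrow> input_pos m \<le> length w + 1 \<Longrightarrow> input_pos m' \<le> length w + 1"
  by (induction rule: exec.induct) (auto simp: act_def split: prod.split)

section \<open>Compilation to transducers\<close>

text \<open>
  The control state of the compiled machine is the list of programs still to be run.
  \<open>conts p k\<close> contains the lists that can arise while \<open>p\<close> runs in front of \<open>k\<close>, up to and including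
  \<open>k\<close>. As a loop body returns to the same loop, there are only finitely many.
\<close>

primrec conts :: "('r, 's, 'x) prog \<Rightarrow> ('r, 's, 'x) prog list \<Rightarrow> ('r, 's, 'x) prog list set" where
  "conts (Do f) k = {Do f # k, k}"
| "conts (p ;; q) k = insert ((p ;; q) # k) (conts p (q # k) \<union> conts q k)"
| "conts (Cond b p q) k = insert (Cond b p q # k) (conts p k \<union> conts q k)"
| "conts (While b p) k = {While b p # k, k} \<union> conts p (While b p # k)"

fun control_step :: "('r, 's, 'x) prog list \<times> 'r \<Rightarrow> 'x input_symbol \<Rightarrow> 's \<Rightarrow>
    ((('r, 's, 'x) prog list \<times> 'r) \<times> 's \<times> move \<times> move \<times> 'x list) option" where
  "control_step ([], r) x s = None"
| "control_step (Do f # k, r) x s =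
     (case f r x s of (r', s', d, e, z) \<Rightarrow> Some ((k, r'), s', d, e, z))"
| "control_step ((p ;; q) # k, r) x s = Some ((p # q # k, r), s, Stay, Stay, [])"
| "control_step (Cond b p q # k, r) x s =
     Some (((if b r x s then p else q) # k, r), s, Stay, Stay, [])"
| "control_step (While b p # k, r) x s =
     Some ((if b r x s then p # While b p # k else k, r), s, Stay, Stay, [])"

primrec preserves :: "'r set \<Rightarrow> ('r, 's, 'x) prog \<Rightarrow> bool" where
  "preserves R (Do f) \<longleftrightarrow> (\<forall>r\<in>R. \<forall>x s. fst (f r x s) \<in> R)"
| "preserves R (p ;; q) \<longleftrightarrow> preserves R p \<and> preserves R q"
| "preserves R (Cond b p q) \<longleftrightarrow> preserves R p \<and> preserves R q"
| "preserves R (While b p) \<longleftrightarrow> preserves R p"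

definition machine ::
    "'r set \<Rightarrow> 'r \<Rightarrow> 's \<Rightarrow> ('r, 's, 'x) prog \<Rightarrow> (('r, 's, 'x) prog list \<times> 'r, 's, 'x) transducer" where
  "machine R r0 b p =
     \<lparr>states = conts p [] \<times> R, initial = ([p], r0), work_alphabet = UNIV, blank = b,
      transition = control_step\<rparr>"

definition with_control ::
    "'c \<Rightarrow> ('r, 's, 'x) config \<Rightarrow> ('c \<times> 'r, 's, 'x) config" where
  "with_control k m =
     \<lparr>state = (k, state m), input_pos = input_pos m, work_tape = work_tape m,
      work_pos = work_pos m, out_tape = out_tape m\<rparr>"

lemma finite_conts: "finite (conts p k)"
  by (induction p arbitrary: k) auto

lemma conts_start: "p # k \<in> conts p k"
  by (cases p) auto

text \<open>Leaving \<open>conts p k\<close> is possible only from \<open>k\<close>, that is, after \<open>p\<close> has finished.\<close>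

lemma conts_step:
  "l \<in> conts p k \<Longrightarrow> l \<noteq> k \<Longrightarrow> control_step (l, r) x s = Some ((l', r'), z) \<Longrightarrow> l' \<in> conts p k"
proof (induction p arbitrary: k)
  case (Do f)
  then show ?case by (auto split: prod.splits)
next
  case (Seq p q)
  have ss: "l' \<in> conts q k" if "l \<in> conts q k" using Seq.IH(2)[OF that Seq.prems(2,3)] .
  show ?case
  proof (cases "l = (p ;; q) # k")
    case True
    then show ?thesis using Seq.prems conts_start[of p "q # k"] by auto
  next
    case False
    then have "l \<in> conts p (q # k) \<or> l \<in> conts q k" using Seq.prems(1) by simp
    then show ?thesis
      using ss Seq.IH(1)[of "q # k", OF _ _ Seq.prems(3)] conts_start[of q k] by fastforce
  qed
next
  case (Cond b p q)
  show ?case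
  proof (cases "l = Cond b p q # k")
    case True
    then show ?thesis using Cond.prems conts_start[of p k] conts_start[of q k]
      by (auto split: if_splits)
  next
    case False
    then show ?thesis
      using Cond.prems(1) Cond.IH(1)[OF _ Cond.prems(2,3)] Cond.IH(2)[OF _ Cond.prems(2,3)] by auto
  qed
next
  case (While b p)
  show ?case
  proof (cases "l = While b p # k")
    case True
    then show ?thesis using While.prems conts_start[of p "While b p # k"]
      by (auto split: if_splits)
  next
    case False
    then have "l \<in> conts p (While b p # k)" using While.prems(1,2) by simp
    then show ?thesis using False While.IH[of "While b p # k", OF _ _ While.prems(3)] by simp
  qed
qed

lemma conts_preserves:
  "l \<in> conts p k \<Longrightarrow> preserves R p \<Longrightarrow> \<forall>q\<in>set k. preserves R q \<Longrightarrow> \<forall>q\<in>set l. preserves R q"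
proof (induction p arbitrary: k)
  case (Do f)
  then show ?case by auto
next
  case (Seq p q)
  show ?case using Seq.prems Seq.IH(1)[of "q # k"] Seq.IH(2)[of k] by auto
next
  case (Cond b p q)
  show ?case using Cond.prems Cond.IH(1)[of k] Cond.IH(2)[of k] by auto
next
  case (While b p)
  show ?case using While.prems While.IH[of "While b p # k"] by auto
qed

lemma control_step_preserves:
  assumes "control_step (l, r) x s = Some ((l', r'), z)" "r \<in> R" "\<forall>q\<in>set l. preserves R q"
  shows "r' \<in> R"
proof (cases l)
  case (Cons p k)
  show ?thesis
  proof (cases p)
    case (Do f)
    have "fst (f r x s) \<in> R" using assms(2,3) Cons Do by simp
    then show ?thesis using assms(1) Cons Do by (cases "f r x s") auto
  qed (use assms(1,2) Cons in auto)
qed (use assms(1) in auto)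

lemma finite_input_symbols: "finite (UNIV :: 'x::finite input_symbol set)"
proof -
  have "(UNIV :: 'x input_symbol set) \<subseteq> {Left_End, Right_End} \<union> range Letter"
    by (metis UNIV_I Un_iff insert_iff input_symbol.exhaust rangeI subsetI)
  then show ?thesis by (rule finite_subset) auto
qed

lemma wf_machine:
  fixes p :: "('r, 's::finite, 'x::finite) prog"
  assumes "finite R" "r0 \<in> R" "preserves R p"
  shows "wf_transducer (machine R r0 b p)"
proof -
  have closed: "q' \<in> conts p [] \<times> R"
    if q: "q \<in> conts p [] \<times> R" and st: "control_step q x s = Some (q', z)" for q q' x s z
  proof -
    obtain l r l' r' where qq: "q = (l, r)" "q' = (l', r')" by (cases q, cases q')
    have l: "l \<in> conts p []" "r \<in> R" using q qq by auto
    note st = st[unfolded qq]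
    have "l \<noteq> []" using st by auto
    then have "l' \<in> conts p []" by (rule conts_step[OF l(1) _ st])
    moreover have "\<forall>q\<in>set l. preserves R q" using conts_preserves[OF l(1) assms(3)] by simp
    then have "r' \<in> R" by (rule control_step_preserves[OF st l(2)])
    ultimately show ?thesis using qq by simp
  qed
  define len where "len = (\<lambda>(q :: ('r, 's, 'x) prog list \<times> 'r, x, s).
    case control_step q x s of None \<Rightarrow> 0 | Some (q', s', d, e, z) \<Rightarrow> length (z :: 'x list))"
  define A where "A = len ` ((conts p [] \<times> R) \<times> (UNIV :: 'x input_symbol set) \<times> (UNIV :: 's set))"
  have "finite A"
    unfolding A_def
    by (intro finite_imageI finite_cartesian_product finite_conts assms(1) finite_input_symbols
        finite)
  have bound: "length z \<le> Max A"
    if "q \<in> conts p [] \<times> R" "control_step q x s = Some (q', s', d, e, z)" for q x s q' s' d e z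
  proof -
    have "len (q, x, s) \<in> A" unfolding A_def using that(1) by blast
    moreover have "len (q, x, s) = length z" using that(2) by (simp add: len_def)
    ultimately show ?thesis using \<open>finite A\<close> by simp
  qed
  show ?thesis
    unfolding wf_transducer_def machine_def transducer.simps
  proof (intro conjI)
    show "finite (conts p [] \<times> R)" by (intro finite_cartesian_product finite_conts assms(1))
    show "([p], r0) \<in> conts p [] \<times> R" using conts_start[of p "[]"] assms(2) by simp
    show "\<forall>q\<in>conts p [] \<times> R. \<forall>x. \<forall>s\<in>UNIV. \<forall>q' s' d e z.
        control_step q x s = Some (q', s', d, e, z) \<longrightarrow> q' \<in> conts p [] \<times> R \<and> s' \<in> UNIV"
      using closed by blast
    show "\<exists>b. \<forall>q\<in>conts p [] \<times> R. \<forall>x. \<forall>s\<in>UNIV. \<forall>q' s' d e z.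
        control_step q x s = Some (q', s', d, e, z) \<longrightarrow> length z \<le> b"
      using bound by blast
  qed simp_all
qed

section \<open>Space bounds along a run\<close>

definition bounded_run ::
    "('q, 's, 'x) transducer \<Rightarrow> 'x list \<Rightarrow> nat \<Rightarrow> ('q, 's, 'x) config \<Rightarrow> ('q, 's, 'x) config \<Rightarrow> bool" where
  "bounded_run M w B = (\<lambda>c d. step M w c = Some d \<and> work_pos c < B)\<^sup>*\<^sup>*"

lemma bounded_run_refl: "bounded_run M w B c c"
  by (simp add: bounded_run_def)

lemma bounded_run_step:
  "step M w c = Some d \<Longrightarrow> work_pos c < B \<Longrightarrow> bounded_run M w B d e \<Longrightarrow> bounded_run M w B c e"
  unfolding bounded_run_def by (rule converse_rtranclp_into_rtranclp) auto

lemma bounded_run_trans: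
  "bounded_run M w B c d \<Longrightarrow> bounded_run M w B d e \<Longrightarrow> bounded_run M w B c e"
  unfolding bounded_run_def by (rule rtranclp_trans)

lemma with_control_simps [simp]:
  "work_pos (with_control k m) = work_pos m" "out_tape (with_control k m) = out_tape m"
  by (simp_all add: with_control_def)

lemma machine_step:
  "step (machine R r0 b p) w (with_control l m) =
     (case control_step (l, state m) (read_input w m) (read_work m) of
        None \<Rightarrow> None
      | Some ((l', r), s, d, e, z) \<Rightarrow> Some (with_control l' (act w (\<lambda>_ _ _. (r, s, d, e, z)) m)))"
  by (auto simp: step_def machine_def with_control_def read_input_def read_work_def act_def
      split: option.split prod.split)

lemma act_idle:
  "input_pos m \<le> length w + 1 \<Longrightarrow> act w (\<lambda>_ _ _. (state m, read_work m, Stay, Stay, [])) m = m"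
  by (simp add: act_def read_work_def)

text \<open>
  The machine needs idle moves to unfold \<open>Seq\<close>, \<open>Cond\<close> and \<open>While\<close>. They change nothing because the
  input head is within the tape, which is what the hypothesis on \<open>input_pos\<close> is for.
\<close>

lemma exec_bounded_run:
  assumes "exec w B q m m'" "input_pos m \<le> length w + 1"
  shows "bounded_run (machine R r0 b p) w B (with_control (q # k) m) (with_control k m')"
  using assms
proof (induction arbitrary: k rule: exec.induct)
  case (exec_Do m f)
  have "step (machine R r0 b p) w (with_control (Do f # k) m) = Some (with_control k (act w f m))"
    by (cases "f (state m) (read_input w m) (read_work m)") (simp add: machine_step act_def)
  then show ?case
    by (rule bounded_run_step[OF _ _ bounded_run_refl]) (simp add: exec_Do.hyps)
next
  case (exec_Seq p' m m' q m'')
  have "input_pos m' \<le> length w + 1" by (rule exec_input_pos[OF exec_Seq.hyps(1) exec_Seq.prems])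
  note run = bounded_run_trans[OF exec_Seq.IH(1)[OF exec_Seq.prems] exec_Seq.IH(2)[OF this]]
  show ?case
    by (rule bounded_run_step[OF _ _ run])
      (use exec_Seq.prems exec_work_pos[OF exec_Seq.hyps(1)] in \<open>simp_all add: machine_step act_idle\<close>)
next
  case (exec_Cond_True b' m p' m' q)
  show ?case
    by (rule bounded_run_step[OF _ _ exec_Cond_True.IH[OF exec_Cond_True.prems]])
      (use exec_Cond_True.prems exec_Cond_True.hyps(1) exec_work_pos[OF exec_Cond_True.hyps(2)] in
        \<open>simp_all add: machine_step act_idle holds_def\<close>)
next
  case (exec_Cond_False b' m q m' p')
  show ?case
    by (rule bounded_run_step[OF _ _ exec_Cond_False.IH[OF exec_Cond_False.prems]])
      (use exec_Cond_False.prems exec_Cond_False.hyps(1) exec_work_pos[OF exec_Cond_False.hyps(2)] in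
        \<open>simp_all add: machine_step act_idle holds_def\<close>)
next
  case (exec_While_True b' m p' m' m'')
  have "input_pos m' \<le> length w + 1"
    by (rule exec_input_pos[OF exec_While_True.hyps(2) exec_While_True.prems])
  note run = bounded_run_trans[OF exec_While_True.IH(1)[OF exec_While_True.prems]
    exec_While_True.IH(2)[OF this]]
  show ?case
    by (rule bounded_run_step[OF _ _ run])
      (use exec_While_True.prems exec_While_True.hyps(1) exec_work_pos[OF exec_While_True.hyps(2)] in
        \<open>simp_all add: machine_step act_idle holds_def\<close>)
next
  case (exec_While_False b' m p')
  show ?case
    by (rule bounded_run_step[OF _ _ bounded_run_refl])
      (use exec_While_False in \<open>simp_all add: machine_step act_idle holds_def\<close>)
qed

lemma bounded_run_work_pos:
  assumes "bounded_run M w B c d" "work_pos d < B"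
  shows "work_pos c < B"
  using assms unfolding bounded_run_def by (cases rule: converse_rtranclpE) auto

lemma bounded_run_tail:
  assumes "bounded_run M w B c d" "step M w d = None" "step M w c = Some e"
  shows "bounded_run M w B e d"
  using assms unfolding bounded_run_def by (cases rule: converse_rtranclpE) auto

text \<open>
  A deterministic machine has a single run, so a bound along one halting run is a bound on all
  reachable configurations.
\<close>

lemma bounded_run_reachable:
  assumes "bounded_run M w B (init_config M) d" "step M w d = None" "work_pos d < B"
    and "reachable M w c"
  shows "work_pos c < B"
proof -
  have "bounded_run M w B c d"
    using assms(4) unfolding reachable_def
    by (induction rule: rtranclp_induct) (blast intro: assms(1) bounded_run_tail[OF _ assms(2)])+
  then show ?thesis using assms(3) by (rule bounded_run_work_pos)
qed

lemma bounded_run_outputs: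
  assumes "bounded_run M w B (init_config M) d" "step M w d = None" "out_tape d = v"
  shows "outputs M w v"
proof -
  have "reachable M w d"
    using assms(1) unfolding bounded_run_def reachable_def
    by (rule rtranclp_mono[THEN predicate2D, rotated]) auto
  then show ?thesis using assms unfolding outputs_def by blast
qed

section \<open>Independence of the types of states and symbols\<close>

definition rename ::
    "('q \<Rightarrow> 'q') \<Rightarrow> ('s \<Rightarrow> 's') \<Rightarrow> ('q, 's, 'x) transducer \<Rightarrow> ('q', 's', 'x) transducer" where
  "rename f g M =
     \<lparr>states = f ` states M, initial = f (initial M),
      work_alphabet = g ` work_alphabet M, blank = g (blank M),
      transition = (\<lambda>q x s. map_option (\<lambda>(q', s', y). (f q', g s', y))
        (transition M (inv_into (states M) f q) x (inv_into (work_alphabet M) g s)))\<rparr>"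

definition rename_config ::
    "('q \<Rightarrow> 'q') \<Rightarrow> ('s \<Rightarrow> 's') \<Rightarrow> ('q, 's, 'x) config \<Rightarrow> ('q', 's', 'x) config" where
  "rename_config f g c =
     \<lparr>state = f (state c), input_pos = input_pos c, work_tape = g \<circ> work_tape c,
      work_pos = work_pos c, out_tape = out_tape c\<rparr>"

definition config_over :: "('q, 's, 'x) transducer \<Rightarrow> ('q, 's, 'x) config \<Rightarrow> bool" where
  "config_over M c \<longleftrightarrow> state c \<in> states M \<and> (\<forall>i. work_tape c i \<in> work_alphabet M)"

lemma step_config_over:
  assumes "wf_transducer M" "config_over M c" "step M w c = Some d"
  shows "config_over M d"
proof -
  obtain q s e1 e2 z where tr:
    "transition M (state c) (input_at w (input_pos c)) (work_tape c (work_pos c)) = Some (q, s, e1, e2, z)"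
    and d: "state d = q" "work_tape d = (work_tape c)(work_pos c := s)"
    using assms(3) by (auto simp: step_def split: option.splits prod.splits)
  have "state c \<in> states M" "work_tape c (work_pos c) \<in> work_alphabet M"
    using assms(2) by (auto simp: config_over_def)
  then have "q \<in> states M \<and> s \<in> work_alphabet M"
    using assms(1) tr unfolding wf_transducer_def by blast
  then show ?thesis using assms(2) d by (auto simp: config_over_def)
qed

lemma step_rename:
  assumes "inj_on f (states M)" "inj_on g (work_alphabet M)" "config_over M c"
  shows "step (rename f g M) w (rename_config f g c) = map_option (rename_config f g) (step M w c)"
proof -
  have "inv_into (states M) f (f (state c)) = state c"
    "inv_into (work_alphabet M) g (g (work_tape c (work_pos c))) = work_tape c (work_pos c)"
    using assms by (simp_all add: config_over_def)
  then show ?thesis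
    by (cases "transition M (state c) (input_at w (input_pos c)) (work_tape c (work_pos c))")
      (auto simp: step_def rename_def rename_config_def fun_upd_comp)
qed

lemma reachable_config_over:
  assumes "wf_transducer M" "reachable M w c"
  shows "config_over M c"
  using assms(2) unfolding reachable_def
proof (induction rule: rtranclp_induct)
  case base
  then show ?case using assms(1) by (auto simp: config_over_def init_config_def wf_transducer_def)
next
  case (step y z)
  then show ?case using step_config_over[OF assms(1)] by blast
qed

lemma init_rename: "init_config (rename f g M) = rename_config f g (init_config M)"
  by (auto simp: init_config_def rename_config_def rename_def)

lemma reachable_rename_iff:
  assumes wf: "wf_transducer M" and inj: "inj_on f (states M)" "inj_on g (work_alphabet M)"
  shows "reachable (rename f g M) w c' \<longleftrightarrow> (\<exists>c. reachable M w c \<and> c' = rename_config f g c)"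
proof
  assume "reachable (rename f g M) w c'"
  then show "\<exists>c. reachable M w c \<and> c' = rename_config f g c"
    unfolding reachable_def
  proof (induction rule: rtranclp_induct)
    case base
    then show ?case using init_rename by blast
  next
    case (step y z)
    then obtain c where c: "(\<lambda>c d. step M w c = Some d)\<^sup>*\<^sup>* (init_config M) c" "y = rename_config f g c"
      by blast
    have "config_over M c" using reachable_config_over[OF wf] c(1) by (simp add: reachable_def)
    then have "map_option (rename_config f g) (step M w c) = Some z"
      using step.hyps(2) c(2) step_rename[OF inj, of c w] by simp
    then obtain d where "step M w c = Some d" "z = rename_config f g d" by auto
    then show ?case using rtranclp.rtrancl_into_rtrancl[OF c(1)] by blast
  qed
next
  assume "\<exists>c. reachable M w c \<and> c' = rename_config f g c"
  then obtain c where c: "reachable M w c" "c' = rename_config f g c" by blast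
  have "reachable (rename f g M) w (rename_config f g c)"
    using c(1) unfolding reachable_def
  proof (induction rule: rtranclp_induct)
    case base
    then show ?case by (simp add: init_rename)
  next
    case (step y z)
    have "config_over M y" using reachable_config_over[OF wf] step.hyps(1) by (simp add: reachable_def)
    then have "step (rename f g M) w (rename_config f g y) = Some (rename_config f g z)"
      using step.hyps(2) step_rename[OF inj] by simp
    then show ?case by (rule rtranclp.rtrancl_into_rtrancl[OF step.IH])
  qed
  then show "reachable (rename f g M) w c'" using c(2) by simp
qed

lemma wf_rename:
  assumes wf: "wf_transducer M" and inj: "inj_on f (states M)" "inj_on g (work_alphabet M)"
  shows "wf_transducer (rename f g M)"
proof -
  have tr: "\<exists>q1 s1. transition M q x s = Some (q1, s1, y) \<and> q' = f q1 \<and> s' = g s1"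
    if "q \<in> states M" "s \<in> work_alphabet M"
      "transition (rename f g M) (f q) x (g s) = Some (q', s', y)" for q x s q' s' y
    using that inj by (auto simp: rename_def)
  have "\<exists>n. \<forall>q\<in>states M. \<forall>x. \<forall>s\<in>work_alphabet M. \<forall>q' s' d e z.
      transition M q x s = Some (q', s', d, e, z) \<longrightarrow> length z \<le> n"
    using wf unfolding wf_transducer_def by (elim conjE)
  then obtain n where n0: "\<forall>q\<in>states M. \<forall>x. \<forall>s\<in>work_alphabet M. \<forall>q' s' d e z.
      transition M q x s = Some (q', s', d, e, z) \<longrightarrow> length z \<le> n" ..
  have n: "length z \<le> n" if "q \<in> states M" "s \<in> work_alphabet M"
    "transition M q x s = Some (q', s', d, e, z)" for q x s q' s' d e z
    using n0 that by blast
  have cl: "q' \<in> states M \<and> s' \<in> work_alphabet M"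
    if "q \<in> states M" "s \<in> work_alphabet M" "transition M q x s = Some (q', s', d, e, z)"
    for q x s q' s' d e z
    using wf that unfolding wf_transducer_def by blast
  have sets: "states (rename f g M) = f ` states M" "work_alphabet (rename f g M) = g ` work_alphabet M"
    by (simp_all add: rename_def)
  show ?thesis
    unfolding wf_transducer_def sets
  proof (intro conjI)
    have "length z \<le> n" if "q \<in> f ` states M" "s \<in> g ` work_alphabet M"
      "transition (rename f g M) q x s = Some (q', s', d, e, z)" for q x s q' s' d e z
    proof -
      from that(1,2) obtain q0 s0
        where qs: "q0 \<in> states M" "q = f q0" "s0 \<in> work_alphabet M" "s = g s0" by blast
      show ?thesis using tr[OF qs(1,3) that(3)[unfolded qs]] n[OF qs(1,3)] by blast
    qed
    then show "\<exists>b. \<forall>q\<in>f ` states M. \<forall>x. \<forall>s\<in>g ` work_alphabet M. \<forall>q' s' d e z.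
        transition (rename f g M) q x s = Some (q', s', d, e, z) \<longrightarrow> length z \<le> b"
      by blast
    have "q' \<in> f ` states M \<and> s' \<in> g ` work_alphabet M"
      if "q \<in> f ` states M" "s \<in> g ` work_alphabet M"
      "transition (rename f g M) q x s = Some (q', s', d, e, z)" for q x s q' s' d e z
    proof -
      from that(1,2) obtain q0 s0
        where qs: "q0 \<in> states M" "q = f q0" "s0 \<in> work_alphabet M" "s = g s0" by blast
      show ?thesis using tr[OF qs(1,3) that(3)[unfolded qs]] cl[OF qs(1,3)] by blast
    qed
    then show "\<forall>q\<in>f ` states M. \<forall>x. \<forall>s\<in>g ` work_alphabet M. \<forall>q' s' d e z.
        transition (rename f g M) q x s = Some (q', s', d, e, z) \<longrightarrow>
        q' \<in> f ` states M \<and> s' \<in> g ` work_alphabet M"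
      by blast
  qed (use wf in \<open>auto simp: rename_def wf_transducer_def\<close>)
qed

lemma logspace_computable_rename:
  fixes M :: "('q, 's, 'x::finite) transducer"
  assumes "logspace_transducer M" "\<And>w. outputs M w (f w)"
  shows "logspace_computable f"
proof -
  have wf: "wf_transducer M" using assms(1) by (simp add: logspace_transducer_def)
  obtain a :: "'q \<Rightarrow> nat" where a: "inj_on a (states M)"
    using wf finite_imp_inj_to_nat_seg unfolding wf_transducer_def by metis
  obtain b :: "'s \<Rightarrow> nat" where b: "inj_on b (work_alphabet M)"
    using wf finite_imp_inj_to_nat_seg unfolding wf_transducer_def by metis
  note reach = reachable_rename_iff[OF wf a b]
  obtain C where C: "\<And>w c. reachable M w c \<Longrightarrow>
      real (work_pos c + 1) \<le> C * log 2 (real (max 2 (length w)))"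
    using assms(1) unfolding logspace_transducer_def by blast
  have "logspace_transducer (rename a b M)"
    unfolding logspace_transducer_def using wf_rename[OF wf a b] C
    by (auto simp: reach rename_config_def intro!: exI[of _ C])
  moreover have "outputs (rename a b M) w (f w)" for w
  proof -
    obtain c where c: "reachable M w c" "step M w c = None" "out_tape c = f w"
      using assms(2)[of w] unfolding outputs_def by blast
    then have "step (rename a b M) w (rename_config a b c) = None"
      using step_rename[OF a b reachable_config_over[OF wf c(1)]] by simp
    then show ?thesis using c unfolding outputs_def reach
      by (auto simp: rename_config_def intro!: exI[of _ "rename_config a b c"])
  qed
  ultimately show ?thesis unfolding logspace_computable_def by blast
qed

text \<open>
  What remains for a concrete function: a program for it, and an execution on every input within
  logarithmic space.
\<close>

theorem logspace_computable_program:
  fixes p :: "('r, 's::finite, 'x::finite) prog" and C :: real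
  assumes "finite R" "r0 \<in> R" "preserves R p"
    and run: "\<And>w. \<exists>B m. exec w B p
      \<lparr>state = r0, input_pos = 0, work_tape = (\<lambda>_. b), work_pos = 0, out_tape = []\<rparr> m \<and>
      work_pos m < B \<and> out_tape m = f w \<and> real B \<le> C * log 2 (real (max 2 (length w)))"
  shows "logspace_computable f"
proof (rule logspace_computable_rename)
  let ?M = "machine R r0 b p"
  define m0 :: "('r, 's, 'x) config" where
    "m0 = \<lparr>state = r0, input_pos = 0, work_tape = (\<lambda>_. b), work_pos = 0, out_tape = []\<rparr>"
  have init: "init_config ?M = with_control [p] m0"
    by (simp add: init_config_def machine_def with_control_def m0_def)
  have runs: "\<exists>B m. bounded_run ?M w B (init_config ?M) (with_control [] m) \<and> work_pos m < B \<and>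
      out_tape m = f w \<and> real B \<le> C * log 2 (real (max 2 (length w)))" for w
    using run[of w] exec_bounded_run[of w _ p m0 _ R r0 b p "[]"] unfolding m0_def[symmetric] init
    by (fastforce simp: m0_def)
  have halt: "step ?M w (with_control [] m) = None" for w m
    by (simp add: machine_step)
  show "logspace_transducer ?M"
    unfolding logspace_transducer_def
  proof (intro conjI exI allI impI)
    fix w c assume c: "reachable ?M w c"
    obtain B m where "bounded_run ?M w B (init_config ?M) (with_control [] m)" "work_pos m < B"
      "real B \<le> C * log 2 (real (max 2 (length w)))"
      using runs by blast
    then show "real (work_pos c + 1) \<le> C * log 2 (real (max 2 (length w)))"
      using bounded_run_reachable[OF _ halt _ c, of B m] by (simp add: with_control_def)
  qed (rule wf_machine[OF assms(1-3)])
  show "outputs ?M w (f w)" for w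
    using runs[of w] bounded_run_outputs[OF _ halt] by (force simp: with_control_def)
qed

section \<open>Binary counters on the work tape\<close>

text \<open>
  All counters share the work tape as parallel tracks: a cell holds one bit of each counter, least
  significant bits next to the left end. Square \<open>0\<close> carries a mark, so that the head can find its way
  home, and the first blank square ends the numbers. A number may have leading zeros.
\<close>

datatype 'v sym = Blank | Mark | Cell "'v \<Rightarrow> bool"

instance sym :: (finite) finite
proof
  have "(UNIV :: 'a sym set) \<subseteq> {Blank, Mark} \<union> range Cell"
    by (metis UNIV_I Un_iff insert_iff rangeI subsetI sym.exhaust)
  then show "finite (UNIV :: 'a sym set)" by (rule finite_subset) auto
qed

fun val :: "'v \<Rightarrow> ('v \<Rightarrow> bool) list \<Rightarrow> nat" where
  "val v [] = 0"
| "val v (c # cs) = of_bool (c v) + 2 * val v cs"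

lemma val_less: "val v cs < 2 ^ length cs"
  by (induction cs) auto

lemma val_append: "val v (cs @ ds) = val v cs + 2 ^ length cs * val v ds"
  by (induction cs) (auto simp: algebra_simps)

definition tape :: "('v \<Rightarrow> bool) list \<Rightarrow> nat \<Rightarrow> 'v sym" where
  "tape cs i = (if i = 0 then Mark else if i \<le> length cs then Cell (cs ! (i - 1)) else Blank)"

lemma tape_simps [simp]:
  "tape cs 0 = Mark"
  "tape (xs @ c # ys) (Suc (length xs)) = Cell c"
  "tape xs (Suc (length xs)) = Blank"
  "(tape (xs @ c # ys))(Suc (length xs) := Cell d) = tape (xs @ d # ys)"
  "(tape xs)(Suc (length xs) := Cell d) = tape (xs @ [d])"
  "(tape xs)(Suc (length xs) := Blank) = tape xs"
  "(tape xs)(0 := Mark) = tape xs"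
  by (auto simp: tape_def fun_eq_iff nth_append nth_Cons split: nat.splits)

type_synonym ('f, 'v, 'x) cprog = "(nat \<times> 'f, 'v sym, 'x) prog"

text \<open>
  Every operation on counters is a sweep over the cells by a finite automaton with output: from left
  to right with \<open>g\<close>, possibly appending one cell at the end, then back with \<open>h\<close>. The state of the
  automaton is the first component of the register. Numbers are processed from the low end on the
  way out, as addition and comparison need it, and from the high end on the way back, as long
  division needs it.
\<close>

definition right_loop :: "(nat \<Rightarrow> ('v \<Rightarrow> bool) \<Rightarrow> nat \<times> ('v \<Rightarrow> bool)) \<Rightarrow> ('f, 'v, 'x) cprog" where
  "right_loop g = While (\<lambda>_ _ s. s \<noteq> Blank)
     (Do (\<lambda>(a, f) _ s. case s of
        Cell c \<Rightarrow> ((fst (g a c), f), Cell (snd (g a c)), Stay, Move_Right, [])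
      | _ \<Rightarrow> ((a, f), s, Stay, Stay, [])))"

definition left_loop :: "(nat \<Rightarrow> ('v \<Rightarrow> bool) \<Rightarrow> nat \<times> ('v \<Rightarrow> bool)) \<Rightarrow> ('f, 'v, 'x) cprog" where
  "left_loop h = While (\<lambda>_ _ s. s \<noteq> Mark)
     (Do (\<lambda>(a, f) _ s. case s of
        Cell c \<Rightarrow> ((fst (h a c), f), Cell (snd (h a c)), Stay, Move_Left, [])
      | _ \<Rightarrow> ((a, f), s, Stay, Stay, [])))"

definition sweep :: "nat \<Rightarrow> (nat \<Rightarrow> ('v \<Rightarrow> bool) \<Rightarrow> nat \<times> ('v \<Rightarrow> bool)) \<Rightarrow>
    (nat \<Rightarrow> ('v \<Rightarrow> bool) option) \<Rightarrow> (nat \<Rightarrow> nat) \<Rightarrow>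
    (nat \<Rightarrow> ('v \<Rightarrow> bool) \<Rightarrow> nat \<times> ('v \<Rightarrow> bool)) \<Rightarrow> ('f, 'v, 'x) cprog" where
  "sweep a0 g e b h =
     Do (\<lambda>(_, f) _ s. ((a0, f), s, Stay, Move_Right, [])) ;;
     right_loop g ;;
     Do (\<lambda>(a, f) _ _. ((b a, f), (case e a of None \<Rightarrow> Blank | Some c \<Rightarrow> Cell c), Stay, Move_Left, [])) ;;
     left_loop h"

lemma preserves_sweep:
  assumes "a0 \<le> n" "\<And>a c. a \<le> n \<Longrightarrow> fst (g a c) \<le> n" "\<And>a. a \<le> n \<Longrightarrow> b a \<le> n"
    "\<And>a c. a \<le> n \<Longrightarrow> fst (h a c) \<le> n"
  shows "preserves ({..n} \<times> F) (sweep a0 g e b h)"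
  using assms by (auto simp: sweep_def right_loop_def left_loop_def split: sym.split)

fun mealy :: "(nat \<Rightarrow> 'c \<Rightarrow> nat \<times> 'c) \<Rightarrow> nat \<Rightarrow> 'c list \<Rightarrow> nat \<times> 'c list" where
  "mealy g a [] = (a, [])"
| "mealy g a (c # cs) =
     (fst (mealy g (fst (g a c)) cs), snd (g a c) # snd (mealy g (fst (g a c)) cs))"

fun mealy_left :: "(nat \<Rightarrow> 'c \<Rightarrow> nat \<times> 'c) \<Rightarrow> nat \<Rightarrow> 'c list \<Rightarrow> nat \<times> 'c list" where
  "mealy_left h a [] = (a, [])"
| "mealy_left h a (c # cs) =
     (fst (h (fst (mealy_left h a cs)) c), snd (h (fst (mealy_left h a cs)) c) # snd (mealy_left h a cs))"

lemma mealy_left_snoc: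
  "mealy_left h a (cs @ [c]) =
     (fst (mealy_left h (fst (h a c)) cs), snd (mealy_left h (fst (h a c)) cs) @ [snd (h a c)])"
  by (induction cs) auto

lemma mealy_Pair [simp]: "mealy Pair a cs = (a, cs)" "mealy_left Pair a cs = (a, cs)"
  by (induction cs) auto

lemma length_mealy [simp]: "length (snd (mealy g a cs)) = length cs"
  by (induction cs arbitrary: a) auto

lemma length_mealy_left [simp]: "length (snd (mealy_left g a cs)) = length cs"
  by (induction cs arbitrary: a) auto

definition cells_config ::
    "nat \<Rightarrow> 'f \<Rightarrow> nat \<Rightarrow> ('v \<Rightarrow> bool) list \<Rightarrow> nat \<Rightarrow> 'x list \<Rightarrow> (nat \<times> 'f, 'v sym, 'x) config" where
  "cells_config a f i cs j z =
     \<lparr>state = (a, f), input_pos = i, work_tape = tape cs, work_pos = j, out_tape = z\<rparr>"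

lemma work_pos_cells_config [simp]: "work_pos (cells_config a f i cs j z) = j"
  by (simp add: cells_config_def)

lemma exec_Do_eq: "work_pos m < B \<Longrightarrow> act w f m = m' \<Longrightarrow> exec w B (Do f) m m'"
  using exec_Do by blast

lemma exec_right_loop:
  assumes "length xs + length ys + 1 < B" "i \<le> length w + 1"
  shows "exec w B (right_loop g) (cells_config a f i (xs @ ys) (Suc (length xs)) z)
    (cells_config (fst (mealy g a ys)) f i (xs @ snd (mealy g a ys)) (Suc (length xs + length ys)) z)"
  using assms(1)
proof (induction ys arbitrary: xs a)
  case Nil
  then show ?case unfolding right_loop_def
    by (auto intro!: exec_While_False simp: holds_def cells_config_def read_work_def)
next
  case (Cons c ys)
  have "exec w B (right_loop g)
      (cells_config (fst (g a c)) f i (xs @ snd (g a c) # ys) (Suc (Suc (length xs))) z)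
      (cells_config (fst (mealy g a (c # ys))) f i (xs @ snd (mealy g a (c # ys)))
        (Suc (length xs + length (c # ys))) z)"
    using Cons.IH[of "xs @ [snd (g a c)]" "fst (g a c)"] Cons.prems by simp
  then show ?case unfolding right_loop_def
    by (rule exec_While_True[rotated 2])
      (use Cons.prems assms(2) in
        \<open>auto intro!: exec_Do_eq simp: holds_def cells_config_def read_work_def act_def\<close>)
qed

lemma exec_left_loop:
  assumes "length xs < B" "i \<le> length w + 1"
  shows "exec w B (left_loop h) (cells_config a f i (xs @ ys) (length xs) z)
    (cells_config (fst (mealy_left h a xs)) f i (snd (mealy_left h a xs) @ ys) 0 z)"
  using assms(1)
proof (induction xs arbitrary: ys a rule: rev_induct)
  case Nil
  then show ?case unfolding left_loop_def
    by (auto intro!: exec_While_False simp: holds_def cells_config_def read_work_def)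
next
  case (snoc c xs)
  have "exec w B (left_loop h)
      (cells_config (fst (h a c)) f i (xs @ snd (h a c) # ys) (length xs) z)
      (cells_config (fst (mealy_left h a (xs @ [c]))) f i (snd (mealy_left h a (xs @ [c])) @ ys) 0 z)"
    using snoc.IH[of "fst (h a c)" "snd (h a c) # ys"] snoc.prems by (simp add: mealy_left_snoc)
  then show ?case unfolding left_loop_def
    by (rule exec_While_True[rotated 2])
      (use snoc.prems assms(2) in
        \<open>auto intro!: exec_Do_eq simp: holds_def cells_config_def read_work_def act_def\<close>)
qed

lemma exec_sweep:
  fixes cs :: "('v \<Rightarrow> bool) list" and g h a0 b
  assumes "length cs + 1 < B" "i \<le> length w + 1"
  defines "y \<equiv> mealy g a0 cs"
  defines "y' \<equiv> mealy_left h (b (fst y)) (snd y)"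
  shows "exec w B (sweep a0 g e b h) (cells_config a f i cs 0 z)
    (cells_config (fst y') f i (snd y' @ (case e (fst y) of None \<Rightarrow> [] | Some c \<Rightarrow> [c])) 0 z)"
proof -
  define ext where "ext = (case e (fst y) of None \<Rightarrow> [] | Some c \<Rightarrow> [c])"
  have start: "exec w B (Do (\<lambda>(_, f) _ s. ((a0, f), s, Stay, Move_Right, [])))
      (cells_config a f i cs 0 z) (cells_config a0 f i cs 1 z)"
    using assms(1,2)
    by (intro exec_Do_eq) (auto simp: cells_config_def read_work_def act_def)
  have right: "exec w B (right_loop g) (cells_config a0 f i cs 1 z)
      (cells_config (fst y) f i (snd y) (Suc (length cs)) z)"
    using exec_right_loop[of "[]" cs B i w g a0 f z] assms(1,2) by (simp add: y_def)
  have len: "length (snd y) = length cs" by (simp add: y_def)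
  have turn: "exec w B (Do (\<lambda>(a, f) _ _. ((b a, f),
        (case e a of None \<Rightarrow> Blank | Some c \<Rightarrow> Cell c), Stay, Move_Left, [])))
      (cells_config (fst y) f i (snd y) (Suc (length cs)) z)
      (cells_config (b (fst y)) f i (snd y @ ext) (length cs) z)"
    using assms(1,2)
    by (intro exec_Do_eq)
      (auto simp: cells_config_def act_def ext_def len[symmetric] split: option.split)
  have left: "exec w B (left_loop h) (cells_config (b (fst y)) f i (snd y @ ext) (length cs) z)
      (cells_config (fst y') f i (snd y' @ ext) 0 z)"
    using exec_left_loop[of "snd y" B i w h "b (fst y)" f ext z] assms(1,2) len by (simp add: y'_def)
  show ?thesis
    unfolding sweep_def ext_def[symmetric]
    by (rule exec_Seq[OF start exec_Seq[OF right exec_Seq[OF turn left]]])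
qed

section \<open>Reasoning about counter programs\<close>

text \<open>
  Between two operations the work head is at home, and a program is specified by what it does to the
  values of the counters. The parameter \<open>l\<close> bounds the number of cells: \<open>wp w l p Q s\<close> says that \<open>p\<close>,
  started with the counter values of \<open>s\<close> on at most \<open>l\<close> cells, terminates with values satisfying \<open>Q\<close>
  and again on at most \<open>l\<close> cells.
\<close>

record ('f, 'v, 'x) cstate =
  aux :: nat
  flags :: 'f
  env :: "'v \<Rightarrow> nat"
  ipos :: nat
  out :: "'x list"

definition represents ::
    "'x list \<Rightarrow> nat \<Rightarrow> (nat \<times> 'f, 'v sym, 'x) config \<Rightarrow> ('f, 'v, 'x) cstate \<Rightarrow> bool" where
  "represents w l m s \<longleftrightarrow> ipos s \<le> length w + 1 \<and>
     (\<exists>cs. length cs \<le> l \<and> env s = (\<lambda>v. val v cs) \<and>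
       m = cells_config (aux s) (flags s) (ipos s) cs 0 (out s))"

definition wp :: "'x list \<Rightarrow> nat \<Rightarrow> ('f, 'v, 'x) cprog \<Rightarrow> (('f, 'v, 'x) cstate \<Rightarrow> bool) \<Rightarrow>
    ('f, 'v, 'x) cstate \<Rightarrow> bool" where
  "wp w l p Q s \<longleftrightarrow> (\<forall>m. represents w l m s \<longrightarrow>
     (\<exists>m' s'. exec w (l + 2) p m m' \<and> represents w l m' s' \<and> Q s'))"

lemma wp_Seq: "wp w l p (wp w l q Q) s \<Longrightarrow> wp w l (p ;; q) Q s"
  unfolding wp_def by (meson exec_Seq)

lemma wp_mono: "wp w l p Q s \<Longrightarrow> (\<And>s'. Q s' \<Longrightarrow> Q' s') \<Longrightarrow> wp w l p Q' s"
  unfolding wp_def by meson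

lemma wp_Cond:
  assumes "b (aux s, flags s) (input_at w (ipos s)) \<Longrightarrow> wp w l p Q s"
    "\<not> b (aux s, flags s) (input_at w (ipos s)) \<Longrightarrow> wp w l q Q s"
  shows "wp w l (Cond (\<lambda>r x _. b r x) p q) Q s"
  unfolding wp_def
proof (intro allI impI)
  fix m assume m: "represents w l m s"
  have "holds w (\<lambda>r x _. b r x) m \<longleftrightarrow> b (aux s, flags s) (input_at w (ipos s))"
    using m by (auto simp: represents_def holds_def cells_config_def read_input_def)
  then show "\<exists>m' s'. exec w (l + 2) (Cond (\<lambda>r x _. b r x) p q) m m' \<and>
      represents w l m' s' \<and> Q s'"
    using assms m unfolding wp_def by (meson exec_Cond_True exec_Cond_False)
qed

text \<open>Here \<open>n\<close> is the number of rounds and \<open>I k\<close> holds after \<open>k\<close> of them; this gives termination as well.\<close>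

lemma wp_While:
  assumes "I 0 s"
    and step: "\<And>k s. k < n \<Longrightarrow> I k s \<Longrightarrow>
      b (aux s, flags s) (input_at w (ipos s)) \<and> wp w l p (I (Suc k)) s"
    and final: "\<And>s. I n s \<Longrightarrow> \<not> b (aux s, flags s) (input_at w (ipos s)) \<and> Q s"
  shows "wp w l (While (\<lambda>r x _. b r x) p) Q s"
proof -
  have b: "holds w (\<lambda>r x _. b r x) m \<longleftrightarrow> b (aux s, flags s) (input_at w (ipos s))"
    if "represents w l m s" for m s
    using that by (auto simp: represents_def holds_def cells_config_def read_input_def)
  have pos: "work_pos m < l + 2" if "represents w l m s" for m s
    using that by (auto simp: represents_def)
  have "\<exists>m' s'. exec w (l + 2) (While (\<lambda>r x _. b r x) p) m m' \<and> represents w l m' s' \<and> Q s'"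
    if "k \<le> n" "I k s" "represents w l m s" for k s m
    using that
  proof (induction "n - k" arbitrary: k s m)
    case 0
    then have "\<not> holds w (\<lambda>r x _. b r x) m" "Q s" using final[of s] b by auto
    then show ?case using exec_While_False[OF _ pos] 0 by blast
  next
    case (Suc d)
    then have k: "k < n" by simp
    have "holds w (\<lambda>r x _. b r x) m" using step[OF k Suc.prems(2)] b[OF Suc.prems(3)] by simp
    moreover obtain m1 s1 where
      1: "exec w (l + 2) p m m1" "represents w l m1 s1" "I (Suc k) s1"
      using step[OF k Suc.prems(2)] Suc.prems(3) unfolding wp_def by blast
    moreover have "\<exists>m' s'. exec w (l + 2) (While (\<lambda>r x _. b r x) p) m1 m' \<and>
        represents w l m' s' \<and> Q s'"
      by (rule Suc.hyps(1)[OF _ _ 1(3,2)]) (use Suc.hyps(2) k in simp_all)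
    ultimately show ?case using exec_While_True by blast
  qed
  then show ?thesis using assms(1) unfolding wp_def by blast
qed

text \<open>
  A move made at home rewrites the mark. On the blank initial tape it thereby creates the mark.
\<close>

definition home ::
    "(nat \<times> 'f \<Rightarrow> 'x input_symbol \<Rightarrow> (nat \<times> 'f) \<times> move \<times> 'x list) \<Rightarrow> ('f, 'v, 'x) cprog" where
  "home f = Do (\<lambda>r x _. case f r x of (r', d, z) \<Rightarrow> (r', Mark, d, Stay, z))"

lemma wp_home:
  assumes "f (aux s, flags s) (input_at w (ipos s)) = ((a, g), d, z)"
    and "Q (s\<lparr>aux := a, flags := g, ipos := min (length w + 1) (move_head d (ipos s)), out := out s @ z\<rparr>)"
  shows "wp w l (home f) Q s"
  unfolding wp_def
proof (intro allI impI)
  fix m assume "represents w l m s"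
  then obtain cs where cs: "length cs \<le> l" "env s = (\<lambda>v. val v cs)"
    "m = cells_config (aux s) (flags s) (ipos s) cs 0 (out s)"
    by (auto simp: represents_def)
  let ?s = "s\<lparr>aux := a, flags := g, ipos := min (length w + 1) (move_head d (ipos s)), out := out s @ z\<rparr>"
  let ?m = "cells_config a g (ipos ?s) cs 0 (out ?s)"
  have "exec w (l + 2) (home f) m ?m"
    unfolding home_def using cs(3) assms(1)
    by (intro exec_Do_eq) (auto simp: act_def cells_config_def read_input_def)
  moreover have "represents w l ?m ?s" using cs by (auto simp: represents_def)
  ultimately show "\<exists>m' s'. exec w (l + 2) (home f) m m' \<and> represents w l m' s' \<and> Q s'"
    using assms(2) by blast
qed

lemma wp_sweep:
  assumes "\<And>cs. length cs \<le> l \<Longrightarrow> env s = (\<lambda>v. val v cs) \<Longrightarrow>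
    \<exists>a' cs'. mealy_left h (b (fst (mealy g a0 cs))) (snd (mealy g a0 cs)) = (a', cs') \<and>
      (let ds = cs' @ (case e (fst (mealy g a0 cs)) of None \<Rightarrow> [] | Some c \<Rightarrow> [c]) in
        length ds \<le> l \<and> Q (s\<lparr>aux := a', env := (\<lambda>v. val v ds)\<rparr>))"
  shows "wp w l (sweep a0 g e b h) Q s"
  unfolding wp_def
proof (intro allI impI)
  fix m assume "represents w l m s"
  then obtain cs where cs: "length cs \<le> l" "env s = (\<lambda>v. val v cs)" "ipos s \<le> length w + 1"
    "m = cells_config (aux s) (flags s) (ipos s) cs 0 (out s)"
    by (auto simp: represents_def)
  obtain a' cs' ds where r: "mealy_left h (b (fst (mealy g a0 cs))) (snd (mealy g a0 cs)) = (a', cs')"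
    "ds = cs' @ (case e (fst (mealy g a0 cs)) of None \<Rightarrow> [] | Some c \<Rightarrow> [c])"
    "length ds \<le> l" "Q (s\<lparr>aux := a', env := (\<lambda>v. val v ds)\<rparr>)"
    using assms[OF cs(1,2)] by (auto simp: Let_def)
  have "exec w (l + 2) (sweep a0 g e b h) m (cells_config a' (flags s) (ipos s) ds 0 (out s))"
    using exec_sweep[of cs "l + 2" "ipos s" w a0 g e b h "aux s" "flags s" "out s"] cs r(1,2) by simp
  moreover have "represents w l (cells_config a' (flags s) (ipos s) ds 0 (out s))
      (s\<lparr>aux := a', env := (\<lambda>v. val v ds)\<rparr>)"
    using cs(3) r(3) by (auto simp: represents_def)
  ultimately show "\<exists>m' s'. exec w (l + 2) (sweep a0 g e b h) m m' \<and> represents w l m' s' \<and> Q s'"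
    using r(4) by blast
qed

text \<open>
  The automaton state \<open>a\<close> is the carry in \<open>inc_bit\<close> and the borrow in \<open>dec_bit\<close>. In \<open>compare_bit\<close> it is
  the verdict on the bits read so far (\<open>0\<close> equal, \<open>1\<close> less, \<open>2\<close> greater), which a higher bit
  overrules. In \<open>div_bit\<close> it is the remainder of long division by \<open>p\<close>.
\<close>

definition inc_bit :: "'v \<Rightarrow> nat \<Rightarrow> ('v \<Rightarrow> bool) \<Rightarrow> nat \<times> ('v \<Rightarrow> bool)" where
  "inc_bit v a c = (if a = 1 then (of_bool (c v), c(v := \<not> c v)) else (0, c))"

definition dec_bit :: "'v \<Rightarrow> nat \<Rightarrow> ('v \<Rightarrow> bool) \<Rightarrow> nat \<times> ('v \<Rightarrow> bool)" where
  "dec_bit v a c = (if a = 1 then (of_bool (\<not> c v), c(v := \<not> c v)) else (0, c))"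

definition compare_bit :: "'v \<Rightarrow> 'v \<Rightarrow> nat \<Rightarrow> ('v \<Rightarrow> bool) \<Rightarrow> nat \<times> ('v \<Rightarrow> bool)" where
  "compare_bit u v a c = (if c u = c v then a else if c v then 1 else 2, c)"

definition div_bit :: "nat \<Rightarrow> 'v \<Rightarrow> nat \<Rightarrow> ('v \<Rightarrow> bool) \<Rightarrow> nat \<times> ('v \<Rightarrow> bool)" where
  "div_bit p v a c = ((2 * a + of_bool (c v)) mod p, c(v := p \<le> 2 * a + of_bool (c v)))"

definition inc :: "'v \<Rightarrow> ('f, 'v, 'x) cprog" where
  "inc v = sweep 1 (inc_bit v) (\<lambda>a. if a = 1 then Some (\<lambda>u. u = v) else None) (\<lambda>_. 0) Pair"

definition dec :: "'v \<Rightarrow> ('f, 'v, 'x) cprog" where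
  "dec v = sweep 1 (dec_bit v) (\<lambda>_. None) (\<lambda>_. 0) Pair"

definition compare :: "'v \<Rightarrow> 'v \<Rightarrow> ('f, 'v, 'x) cprog" where
  "compare u v = sweep 0 (compare_bit u v) (\<lambda>_. None) id Pair"

definition clear :: "'v \<Rightarrow> ('f, 'v, 'x) cprog" where
  "clear v = sweep 0 (\<lambda>a c. (a, c(v := False))) (\<lambda>_. None) id Pair"

definition copy :: "'v \<Rightarrow> 'v \<Rightarrow> ('f, 'v, 'x) cprog" where
  "copy v u = sweep 0 (\<lambda>a c. (a, c(v := c u))) (\<lambda>_. None) id Pair"

definition divmod :: "nat \<Rightarrow> 'v \<Rightarrow> ('f, 'v, 'x) cprog" where
  "divmod p v = sweep 0 Pair (\<lambda>_. None) (\<lambda>_. 0) (div_bit p v)"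

lemma preserves_counter_ops:
  assumes "2 \<le> n"
  shows "preserves ({..n} \<times> F) (inc v)" "preserves ({..n} \<times> F) (dec v)"
    "preserves ({..n} \<times> F) (compare u v)" "preserves ({..n} \<times> F) (clear v)"
    "preserves ({..n} \<times> F) (copy v u)" "preserves ({..n} \<times> F) (divmod n v)"
  unfolding inc_def dec_def compare_def clear_def copy_def divmod_def
  using assms
  by (auto intro!: preserves_sweep simp: inc_bit_def dec_bit_def compare_bit_def div_bit_def
      order.strict_implies_order)

lemma mealy_inc:
  assumes "a \<le> 1"
  shows "fst (mealy (inc_bit v) a cs) \<le> 1 \<and>
    val v (snd (mealy (inc_bit v) a cs)) + 2 ^ length cs * fst (mealy (inc_bit v) a cs) =
      val v cs + a \<and>
    (\<forall>u. u \<noteq> v \<longrightarrow> val u (snd (mealy (inc_bit v) a cs)) = val u cs)"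
  using assms
proof (induction cs arbitrary: a)
  case (Cons c cs)
  have "fst (inc_bit v a c) \<le> 1" by (simp add: inc_bit_def)
  from Cons.IH[OF this] show ?case
    using Cons.prems by (cases "a = 0"; cases "c v") (auto simp: inc_bit_def algebra_simps)
qed auto

lemma mealy_dec:
  assumes "a \<le> 1"
  shows "fst (mealy (dec_bit v) a cs) \<le> 1 \<and>
    val v (snd (mealy (dec_bit v) a cs)) + a =
      val v cs + 2 ^ length cs * fst (mealy (dec_bit v) a cs) \<and>
    (\<forall>u. u \<noteq> v \<longrightarrow> val u (snd (mealy (dec_bit v) a cs)) = val u cs)"
  using assms
proof (induction cs arbitrary: a)
  case (Cons c cs)
  have "fst (dec_bit v a c) \<le> 1" by (simp add: dec_bit_def)
  from Cons.IH[OF this] show ?case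
    using Cons.prems by (cases "a = 0"; cases "c v") (auto simp: dec_bit_def algebra_simps)
qed auto

lemma mealy_compare:
  "mealy (compare_bit u v) a cs =
     (if val u cs = val v cs then a else if val u cs < val v cs then 1 else 2, cs)"
proof (induction cs arbitrary: a)
  case (Cons c cs)
  then show ?case by (cases "c u"; cases "c v") (auto simp: compare_bit_def)
qed auto

lemma mealy_assign:
  "mealy (\<lambda>a c. (a, c(v := f c))) a cs = (a, map (\<lambda>c. c(v := f c)) cs)"
  by (induction cs) auto

lemma val_assign_other: "u \<noteq> v \<Longrightarrow> val u (map (\<lambda>c. c(v := f c)) cs) = val u cs"
  by (induction cs) auto

lemma val_clear: "val v (map (\<lambda>c. c(v := False)) cs) = 0"
  by (induction cs) auto

lemma val_copy: "val v (map (\<lambda>c. c(v := c u)) cs) = val u cs"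
  by (induction cs) auto

lemma mealy_left_div:
  assumes "a < p"
  shows "fst (mealy_left (div_bit p v) a cs) < p \<and>
    a * 2 ^ length cs + val v cs =
      p * val v (snd (mealy_left (div_bit p v) a cs)) + fst (mealy_left (div_bit p v) a cs) \<and>
    (\<forall>u. u \<noteq> v \<longrightarrow> val u (snd (mealy_left (div_bit p v) a cs)) = val u cs)"
proof (induction cs)
  case Nil
  then show ?case using assms by simp
next
  case (Cons c cs)
  define r where "r = fst (mealy_left (div_bit p v) a cs)"
  define x where "x = 2 * r + of_bool (c v)"
  define ds where "ds = snd (mealy_left (div_bit p v) a cs)"
  have IH: "r < p" "a * 2 ^ length cs + val v cs = p * val v ds + r"
    "\<forall>u. u \<noteq> v \<longrightarrow> val u ds = val u cs"
    using Cons.IH by (simp_all add: r_def ds_def)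
  have x: "x mod p + p * of_bool (p \<le> x) = x"
  proof (cases "p \<le> x")
    case True
    have "x < 2 * p" using IH(1) by (cases "c v") (simp_all add: x_def)
    then have "x - p < p" using True by linarith
    then have "x mod p = x - p" using True by (simp add: le_mod_geq)
    then show ?thesis using True by simp
  qed simp
  have "a * 2 ^ length (c # cs) + val v (c # cs) = 2 * (a * 2 ^ length cs + val v cs) + of_bool (c v)"
    by simp
  also have "\<dots> = 2 * (p * val v ds) + x" by (simp add: IH(2) x_def)
  also have "\<dots> = p * (of_bool (p \<le> x) + 2 * val v ds) + x mod p"
    using x by (simp add: algebra_simps)
  finally have eq: "a * 2 ^ length (c # cs) + val v (c # cs) =
      p * val v (c(v := p \<le> x) # ds) + x mod p"
    by simp
  have "mealy_left (div_bit p v) a (c # cs) = (x mod p, c(v := p \<le> x) # ds)"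
    by (simp add: div_bit_def x_def r_def ds_def)
  then show ?case using eq IH(3) assms by simp
qed

text \<open>
  A cell is appended only when the carry leaves the last cell, and then the new value is
  \<open>2\<^sup>k\<close> for the old number \<open>k\<close> of cells. A bound on the values thus bounds the number of cells.
\<close>

lemma wp_inc:
  assumes "env s v + 1 < 2 ^ l"
    and "Q (s\<lparr>aux := 0, env := (env s)(v := env s v + 1)\<rparr>)"
  shows "wp w l (inc v) Q s"
  unfolding inc_def
proof (rule wp_sweep)
  fix cs assume cs: "length cs \<le> l" "env s = (\<lambda>v. val v cs)"
  define a ds where "a = fst (mealy (inc_bit v) 1 cs)" and "ds = snd (mealy (inc_bit v) 1 cs)"
  have m: "a \<le> 1" "val v ds + 2 ^ length cs * a = val v cs + 1"
    "\<And>u. u \<noteq> v \<Longrightarrow> val u ds = val u cs" "length ds = length cs"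
    using mealy_inc[of 1 v cs] by (simp_all add: a_def ds_def)
  define ext where "ext = (case (if a = 1 then Some (\<lambda>u. u = v) else None) of None \<Rightarrow> [] | Some c \<Rightarrow> [c])"
  have "length (ds @ ext) \<le> l"
  proof (cases "a = 1")
    case True
    then have "(2::nat) ^ length cs \<le> val v cs + 1" using m(2) by simp
    also have "\<dots> < 2 ^ l" using assms(1) cs(2) by simp
    finally have "length cs < l" by simp
    then show ?thesis using m(4) by (simp add: ext_def True)
  qed (use cs m(4) in \<open>simp add: ext_def\<close>)
  moreover have "(\<lambda>u. val u (ds @ ext)) = (env s)(v := env s v + 1)"
  proof -
    have "a = 0 \<or> a = 1" using m(1) by auto
    then show ?thesis using m cs(2) by (auto simp: ext_def val_append fun_eq_iff)
  qed
  ultimately show "\<exists>a' cs'. mealy_left Pair 0 (snd (mealy (inc_bit v) 1 cs)) = (a', cs') \<and>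
      (let ds = cs' @ (case (if fst (mealy (inc_bit v) 1 cs) = 1 then Some (\<lambda>u. u = v) else None)
          of None \<Rightarrow> [] | Some c \<Rightarrow> [c])
       in length ds \<le> l \<and> Q (s\<lparr>aux := a', env := \<lambda>v. val v ds\<rparr>))"
    using assms(2) unfolding a_def[symmetric] ds_def[symmetric] ext_def[symmetric]
    by (intro exI[of _ 0] exI[of _ ds]) (simp add: Let_def)
qed

lemma wp_dec:
  assumes "0 < env s v"
    and "Q (s\<lparr>aux := 0, env := (env s)(v := env s v - 1)\<rparr>)"
  shows "wp w l (dec v) Q s"
  unfolding dec_def
proof (rule wp_sweep)
  fix cs assume cs: "length cs \<le> l" "env s = (\<lambda>v. val v cs)"
  define a ds where "a = fst (mealy (dec_bit v) 1 cs)" and "ds = snd (mealy (dec_bit v) 1 cs)"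
  have m: "a \<le> 1" "val v ds + 1 = val v cs + 2 ^ length cs * a"
    "\<And>u. u \<noteq> v \<Longrightarrow> val u ds = val u cs" "length ds = length cs"
    using mealy_dec[of 1 v cs] by (simp_all add: a_def ds_def)
  have "a \<noteq> 1" using m(2,4) val_less[of v ds] assms(1) cs(2) by auto
  then have "a = 0" using m(1) by simp
  then have "val v ds = val v cs - 1" using m(2) by simp
  then have "(\<lambda>u. val u ds) = (env s)(v := env s v - 1)"
    using m(3) cs(2) by (auto simp: fun_eq_iff)
  then show "\<exists>a' cs'. mealy_left Pair 0 (snd (mealy (dec_bit v) 1 cs)) = (a', cs') \<and>
      (let ds = cs' @ (case None of None \<Rightarrow> [] | Some c \<Rightarrow> [c])
       in length ds \<le> l \<and> Q (s\<lparr>aux := a', env := \<lambda>v. val v ds\<rparr>))"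
    using assms(2) m(4) cs(1) by (simp add: ds_def Let_def)
qed

lemma wp_compare:
  assumes "Q (s\<lparr>aux := if env s u = env s v then 0 else if env s u < env s v then 1 else 2\<rparr>)"
  shows "wp w l (compare u v) Q s"
  unfolding compare_def
proof (rule wp_sweep)
  fix cs assume cs: "length cs \<le> l" "env s = (\<lambda>v. val v cs)"
  have s: "s\<lparr>aux := a, env := \<lambda>v. val v cs\<rparr> = s\<lparr>aux := a\<rparr>" for a
    using cs(2) by (cases s) simp
  obtain a where a: "mealy (compare_bit u v) 0 cs = (a, cs)" "Q (s\<lparr>aux := a\<rparr>)"
    using assms[unfolded cs(2)] mealy_compare[of u v 0 cs] by blast
  then show "\<exists>a' cs'. mealy_left Pair (id (fst (mealy (compare_bit u v) 0 cs)))
        (snd (mealy (compare_bit u v) 0 cs)) = (a', cs') \<and>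
      (let ds = cs' @ (case None of None \<Rightarrow> [] | Some c \<Rightarrow> [c])
       in length ds \<le> l \<and> Q (s\<lparr>aux := a', env := \<lambda>v. val v ds\<rparr>))"
    using cs(1) by (simp add: s)
qed

lemma wp_clear:
  assumes "Q (s\<lparr>aux := 0, env := (env s)(v := 0)\<rparr>)"
  shows "wp w l (clear v) Q s"
  unfolding clear_def
proof (rule wp_sweep)
  fix cs assume cs: "length cs \<le> l" "env s = (\<lambda>v. val v cs)"
  have "(\<lambda>u. val u (map (\<lambda>c. c(v := False)) cs)) = (env s)(v := 0)"
    using cs(2) by (auto simp: fun_eq_iff val_clear val_assign_other)
  then show "\<exists>a' cs'. mealy_left Pair (id (fst (mealy (\<lambda>a c. (a, c(v := False))) 0 cs)))
        (snd (mealy (\<lambda>a c. (a, c(v := False))) 0 cs)) = (a', cs') \<and>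
      (let ds = cs' @ (case None of None \<Rightarrow> [] | Some c \<Rightarrow> [c])
       in length ds \<le> l \<and> Q (s\<lparr>aux := a', env := \<lambda>v. val v ds\<rparr>))"
    using assms cs(1) mealy_assign[of v "\<lambda>_. False" 0 cs] by simp
qed

lemma wp_copy:
  assumes "Q (s\<lparr>aux := 0, env := (env s)(v := env s u)\<rparr>)"
  shows "wp w l (copy v u) Q s"
  unfolding copy_def
proof (rule wp_sweep)
  fix cs assume cs: "length cs \<le> l" "env s = (\<lambda>v. val v cs)"
  have "(\<lambda>x. val x (map (\<lambda>c. c(v := c u)) cs)) = (env s)(v := env s u)"
    using cs(2) by (auto simp: fun_eq_iff val_copy val_assign_other)
  then show "\<exists>a' cs'. mealy_left Pair (id (fst (mealy (\<lambda>a c. (a, c(v := c u))) 0 cs)))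
        (snd (mealy (\<lambda>a c. (a, c(v := c u))) 0 cs)) = (a', cs') \<and>
      (let ds = cs' @ (case None of None \<Rightarrow> [] | Some c \<Rightarrow> [c])
       in length ds \<le> l \<and> Q (s\<lparr>aux := a', env := \<lambda>v. val v ds\<rparr>))"
    using assms cs(1) mealy_assign[of v "\<lambda>c. c u" 0 cs] by simp
qed

lemma wp_divmod:
  assumes "0 < p"
    and "Q (s\<lparr>aux := env s v mod p, env := (env s)(v := env s v div p)\<rparr>)"
  shows "wp w l (divmod p v) Q s"
  unfolding divmod_def
proof (rule wp_sweep)
  fix cs assume cs: "length cs \<le> l" "env s = (\<lambda>v. val v cs)"
  obtain a ds where a: "mealy_left (div_bit p v) 0 cs = (a, ds)" by (cases "mealy_left (div_bit p v) 0 cs")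
  have m: "a < p" "val v cs = p * val v ds + a" "\<And>u. u \<noteq> v \<Longrightarrow> val u ds = val u cs"
    using mealy_left_div[OF assms(1), of v cs] by (simp_all add: a)
  have "length ds = length cs" using length_mealy_left[of "div_bit p v" 0 cs] by (simp add: a)
  moreover have "a = env s v mod p" "(\<lambda>u. val u ds) = (env s)(v := env s v div p)"
    using m cs(2) by (auto simp: fun_eq_iff)
  ultimately show "\<exists>a' cs'. mealy_left (div_bit p v) 0 (snd (mealy Pair 0 cs)) = (a', cs') \<and>
      (let ds = cs' @ (case None of None \<Rightarrow> [] | Some c \<Rightarrow> [c])
       in length ds \<le> l \<and> Q (s\<lparr>aux := a', env := \<lambda>v. val v ds\<rparr>))"
    using assms(2) cs(1) a by simp
qed

text \<open>The body finds in the register which of the two counters is the smaller one.\<close>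

definition while_differ :: "'v \<Rightarrow> 'v \<Rightarrow> ('f, 'v, 'x) cprog \<Rightarrow> ('f, 'v, 'x) cprog" where
  "while_differ u v p = compare u v ;; While (\<lambda>(a, _) _ _. a \<noteq> 0) (p ;; compare u v)"

lemma wp_while_differ:
  assumes "I 0 s"
    and step: "\<And>k s. k < n \<Longrightarrow> I k s \<Longrightarrow>
      env s u \<noteq> env s v \<and>
      wp w l p (I (Suc k)) (s\<lparr>aux := if env s u < env s v then 1 else 2\<rparr>)"
    and final: "\<And>s. I n s \<Longrightarrow> env s u = env s v \<and> Q (s\<lparr>aux := 0\<rparr>)"
  shows "wp w l (while_differ u v p) Q s"
proof -
  define cmp where "cmp s = s\<lparr>aux := if env s u = env s v then 0
    else if env s u < env s v then 1 else 2\<rparr>" for s :: "('a, 'b, 'c) cstate"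
  define J where "J k s \<longleftrightarrow> (\<exists>s0. I k s0 \<and> s = cmp s0)" for k s
  have "wp w l (While (\<lambda>r _ _. fst r \<noteq> 0) (p ;; compare u v)) Q (cmp s)"
  proof (rule wp_While[where I = J and n = n])
    show "J 0 (cmp s)" using assms(1) by (auto simp: J_def)
  next
    fix k s' assume k: "k < n" "J k s'"
    then obtain s0 where s0: "I k s0" "s' = cmp s0" by (auto simp: J_def)
    have "wp w l p (I (Suc k)) s'" "env s0 u \<noteq> env s0 v"
      using step[OF k(1) s0(1)] by (simp_all add: s0(2) cmp_def)
    then have "wp w l (p ;; compare u v) (J (Suc k)) s'"
      by (intro wp_Seq) (auto elim!: wp_mono intro!: wp_compare simp: J_def cmp_def)
    then show "fst (aux s', flags s') \<noteq> 0 \<and> wp w l (p ;; compare u v) (J (Suc k)) s'"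
      using \<open>env s0 u \<noteq> env s0 v\<close> by (simp add: s0(2) cmp_def)
  next
    fix s' assume "J n s'"
    then obtain s0 where "I n s0" "s' = cmp s0" by (auto simp: J_def)
    then show "\<not> fst (aux s', flags s') \<noteq> 0 \<and> Q s'" using final[of s0] by (simp add: cmp_def)
  qed
  then show ?thesis
    unfolding while_differ_def case_prod_beta
    by (intro wp_Seq wp_compare) (simp add: cmp_def)
qed

section \<open>The affine action of \<open>BS(1,p)\<close>\<close>

fun a_exp :: "bs_gen letter \<Rightarrow> int" where
  "a_exp (Gen_a, b) = (if b then 1 else - 1)"
| "a_exp (Gen_t, b) = 0"

fun t_exp :: "bs_gen letter \<Rightarrow> int" where
  "t_exp (Gen_a, b) = 0"
| "t_exp (Gen_t, b) = (if b then 1 else - 1)"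

definition t_sum :: "bs_gen word \<Rightarrow> int" where
  "t_sum w = sum_list (map t_exp w)"

text \<open>
  The image of \<open>0\<close> under the affine map of a word; \<open>t_sum\<close> is the exponent of its slope.
\<close>

fun shift :: "int \<Rightarrow> bs_gen word \<Rightarrow> rat" where
  "shift p [] = 0"
| "shift p (x # w) = of_int (a_exp x) + of_int p powi t_exp x * shift p w"

lemma t_sum_simps [simp]:
  "t_sum [] = 0" "t_sum (x # w) = t_exp x + t_sum w" "t_sum (u @ v) = t_sum u + t_sum v"
  by (simp_all add: t_sum_def)

lemma shift_append:
  assumes "p \<noteq> 0"
  shows "shift p (u @ v) = shift p u + of_int p powi t_sum u * shift p v"
  using assms by (induction u) (simp_all add: power_int_add algebra_simps)

lemma t_sum_pow_word [simp]: "t_sum (pow_word Gen_a i) = 0" "t_sum (pow_word Gen_t i) = i"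
  by (simp_all add: pow_word_def t_sum_def map_replicate_const sum_list_replicate)

lemma shift_pow_word [simp]:
  "shift p (pow_word Gen_a i) = of_int i" "shift p (pow_word Gen_t i) = 0"
proof -
  have "shift p (replicate k (Gen_a, b)) = (if b then of_nat k else - of_nat k)" for k b
    by (induction k) auto
  then show "shift p (pow_word Gen_a i) = of_int i" by (simp add: pow_word_def)
  have "shift p (replicate k (Gen_t, b)) = 0" for k b
    by (induction k) auto
  then show "shift p (pow_word Gen_t i) = 0" by (simp add: pow_word_def)
qed

lemma pres_eq_affine:
  assumes "p \<noteq> 0" "pres_eq (bs_rel p) u v"
  shows "t_sum u = t_sum v \<and> shift p u = shift p v"
  using assms(2)
proof induction
  case (cancel u x b v)
  then show ?case using assms(1)
    by (cases x; cases b) (simp_all add: shift_append power_int_minus)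
next
  case (relation l r u v)
  then have lr: "l = pow_word Gen_t 1 @ pow_word Gen_a 1 @ pow_word Gen_t (- 1)" "r = pow_word Gen_a p"
    by (auto simp: bs_rel_def)
  show ?case using assms(1) unfolding lr by (simp add: shift_append field_simps)
qed auto

section \<open>Equality in \<open>BS(1,p)\<close> is equality of affine maps\<close>

lemma pres_eq_cancel_end: "pres_eq R (u @ [(x, b), (x, \<not> b)]) u"
  using pres_eq.cancel[of R u x b "[]"] by simp

lemma pow_word_1 [simp]: "pow_word x 0 = []" "pow_word x 1 = [(x, True)]" "pow_word x (- 1) = [(x, False)]"
  by (simp_all add: pow_word_def)

lemma pow_word_snoc:
  "pres_eq R (pow_word x i @ [(x, True)]) (pow_word x (i + 1))"
  "pres_eq R (pow_word x i @ [(x, False)]) (pow_word x (i - 1))"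
proof -
  have suc: "pow_word x (int k) = replicate k (x, True)" for k
    by (simp add: pow_word_def)
  have neg: "pow_word x (- int k) = replicate k (x, False)" for k
    by (cases k) (simp_all add: pow_word_def nat_add_distrib)
  show "pres_eq R (pow_word x i @ [(x, True)]) (pow_word x (i + 1))"
  proof (cases i rule: int_cases2)
    case (nonneg k)
    have "pow_word x (i + 1) = replicate (Suc k) (x, True)" using suc[of "Suc k"] nonneg by (simp add: add.commute)
    then show ?thesis using nonneg suc[of k] by (simp add: replicate_append_same pres_eq.refl)
  next
    case (nonpos k)
    show ?thesis
    proof (cases k)
      case 0
      then show ?thesis using nonpos by (simp add: pres_eq.refl)
    next
      case (Suc j)
      have "i + 1 = - int j" using nonpos Suc by simp
      then show ?thesis using pres_eq_cancel_end[of R "replicate j (x, False)" x False] nonpos Suc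
          neg[of k] neg[of j] by (simp add: replicate_append_same[symmetric] del: replicate_append_same)
    qed
  qed
  show "pres_eq R (pow_word x i @ [(x, False)]) (pow_word x (i - 1))"
  proof (cases i rule: int_cases2)
    case (nonpos k)
    have "i - 1 = - int (Suc k)" using nonpos by simp
    then have "pow_word x (i - 1) = replicate (Suc k) (x, False)" using neg[of "Suc k"] by presburger
    then show ?thesis using nonpos neg[of k] by (simp add: replicate_append_same pres_eq.refl)
  next
    case (nonneg k)
    show ?thesis
    proof (cases k)
      case 0
      then show ?thesis using nonneg by (simp add: pres_eq.refl)
    next
      case (Suc j)
      have "i - 1 = int j" using nonneg Suc by simp
      then show ?thesis using pres_eq_cancel_end[of R "replicate j (x, True)" x True] nonneg Suc
          suc[of k] suc[of j] by (simp add: replicate_append_same[symmetric] del: replicate_append_same)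
    qed
  qed
qed

declare pres_eq.trans [trans]

lemma pow_word_add: "pres_eq R (pow_word x i @ pow_word x j) (pow_word x (i + j))"
proof (induction j rule: int_induct[where k = 0])
  case base
  then show ?case by (simp add: pres_eq.refl)
next
  case (step1 j)
  have "pres_eq R (pow_word x i @ pow_word x (j + 1)) (pow_word x i @ pow_word x j @ [(x, True)])"
    by (rule pres_eq_append[OF pres_eq.refl pres_eq.sym[OF pow_word_snoc(1)]])
  also have "pres_eq R \<dots> (pow_word x (i + j) @ [(x, True)])"
    using pres_eq_append[OF step1(2) pres_eq.refl, of "[(x, True)]"] by simp
  also have "pres_eq R \<dots> (pow_word x (i + j + 1))" by (rule pow_word_snoc)
  finally show ?case by (simp add: add.assoc)
next
  case (step2 j)
  have "pres_eq R (pow_word x i @ pow_word x (j - 1)) (pow_word x i @ pow_word x j @ [(x, False)])"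
    by (rule pres_eq_append[OF pres_eq.refl pres_eq.sym[OF pow_word_snoc(2)]])
  also have "pres_eq R \<dots> (pow_word x (i + j) @ [(x, False)])"
    using pres_eq_append[OF step2(2) pres_eq.refl, of "[(x, False)]"] by simp
  also have "pres_eq R \<dots> (pow_word x (i + j - 1))" by (rule pow_word_snoc)
  finally show ?case by (simp add: algebra_simps)
qed

lemma t_a_letter: "pres_eq (bs_rel p) [(Gen_t, True), (Gen_a, True)] (pow_word Gen_a p @ [(Gen_t, True)])"
proof -
  have "pres_eq (bs_rel p) [(Gen_t, True), (Gen_a, True)]
      ([(Gen_t, True), (Gen_a, True), (Gen_t, False)] @ [(Gen_t, True)])"
    using pres_eq.sym[OF pres_eq_cancel_end[of _ "[(Gen_t, True), (Gen_a, True)]" Gen_t False]] by simp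
  also have "pres_eq (bs_rel p) \<dots> (pow_word Gen_a p @ [(Gen_t, True)])"
    using pres_eq.relation[of "[(Gen_t, True), (Gen_a, True), (Gen_t, False)]" "pow_word Gen_a p"
        "bs_rel p" "[]" "[(Gen_t, True)]"]
    by (simp add: bs_rel_def)
  finally show ?thesis .
qed

lemma t_a_inv_letter:
  "pres_eq (bs_rel p) [(Gen_t, True), (Gen_a, False)] (pow_word Gen_a (- p) @ [(Gen_t, True)])"
proof -
  have "pres_eq (bs_rel p) [(Gen_t, True), (Gen_a, False)]
      ((pow_word Gen_a (- p) @ pow_word Gen_a p) @ [(Gen_t, True), (Gen_a, False)])"
    using pres_eq_append[OF pres_eq.sym[OF pow_word_add[of _ Gen_a "- p" p]] pres_eq.refl] by simp
  also have "pres_eq (bs_rel p) \<dots>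
      (pow_word Gen_a (- p) @ [(Gen_t, True), (Gen_a, True)] @ [(Gen_a, False)])"
    using pres_eq_append[OF pres_eq.refl
      pres_eq_append[OF pres_eq.sym[OF t_a_letter] pres_eq.refl], of p "pow_word Gen_a (- p)" "[(Gen_a, False)]"]
    by simp
  also have "pres_eq (bs_rel p) \<dots> (pow_word Gen_a (- p) @ [(Gen_t, True)])"
    using pres_eq_cancel_end[of _ "pow_word Gen_a (- p) @ [(Gen_t, True)]" Gen_a True] by simp
  finally show ?thesis .
qed

lemma t_a_power:
  "pres_eq (bs_rel p) ([(Gen_t, True)] @ pow_word Gen_a k) (pow_word Gen_a (k * p) @ [(Gen_t, True)])"
proof (induction k rule: int_induct[where k = 0])
  case base
  then show ?case by (simp add: pres_eq.refl)
next
  case (step1 k)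
  have "pres_eq (bs_rel p) ([(Gen_t, True)] @ pow_word Gen_a (k + 1))
      (([(Gen_t, True)] @ pow_word Gen_a k) @ [(Gen_a, True)])"
    using pres_eq_append[OF pres_eq.refl pres_eq.sym[OF pow_word_snoc(1)], of _ "[(Gen_t, True)]" Gen_a k]
    by simp
  also have "pres_eq (bs_rel p) \<dots> (pow_word Gen_a (k * p) @ [(Gen_t, True), (Gen_a, True)])"
    using pres_eq_append[OF step1(2) pres_eq.refl, of "[(Gen_a, True)]"] by simp
  also have "pres_eq (bs_rel p) \<dots> ((pow_word Gen_a (k * p) @ pow_word Gen_a p) @ [(Gen_t, True)])"
    using pres_eq_append[OF pres_eq.refl t_a_letter] by simp
  also have "pres_eq (bs_rel p) \<dots> (pow_word Gen_a (k * p + p) @ [(Gen_t, True)])"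
    by (rule pres_eq_append[OF pow_word_add pres_eq.refl])
  finally show ?case by (simp add: algebra_simps)
next
  case (step2 k)
  have "pres_eq (bs_rel p) ([(Gen_t, True)] @ pow_word Gen_a (k - 1))
      (([(Gen_t, True)] @ pow_word Gen_a k) @ [(Gen_a, False)])"
    using pres_eq_append[OF pres_eq.refl pres_eq.sym[OF pow_word_snoc(2)], of _ "[(Gen_t, True)]" Gen_a k]
    by simp
  also have "pres_eq (bs_rel p) \<dots> (pow_word Gen_a (k * p) @ [(Gen_t, True), (Gen_a, False)])"
    using pres_eq_append[OF step2(2) pres_eq.refl, of "[(Gen_a, False)]"] by simp
  also have "pres_eq (bs_rel p) \<dots> ((pow_word Gen_a (k * p) @ pow_word Gen_a (- p)) @ [(Gen_t, True)])"
    using pres_eq_append[OF pres_eq.refl t_a_inv_letter] by simp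
  also have "pres_eq (bs_rel p) \<dots> (pow_word Gen_a (k * p + - p) @ [(Gen_t, True)])"
    by (rule pres_eq_append[OF pow_word_add pres_eq.refl])
  finally show ?case by (simp add: algebra_simps)
qed

lemma t_power_a_power:
  "pres_eq (bs_rel p) (pow_word Gen_t (int i) @ pow_word Gen_a k)
    (pow_word Gen_a (k * p ^ i) @ pow_word Gen_t (int i))"
proof (induction i arbitrary: k)
  case 0
  then show ?case by (simp add: pres_eq.refl)
next
  case (Suc i)
  have t: "pow_word Gen_t (int (Suc i)) = pow_word Gen_t (int i) @ [(Gen_t, True)]"
    by (simp add: pow_word_def replicate_append_same nat_add_distrib)
  have "pres_eq (bs_rel p) (pow_word Gen_t (int (Suc i)) @ pow_word Gen_a k)
      ((pow_word Gen_t (int i) @ pow_word Gen_a (k * p)) @ [(Gen_t, True)])"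
    using pres_eq_append[OF pres_eq.refl t_a_power] unfolding t by simp
  also have "pres_eq (bs_rel p) \<dots> ((pow_word Gen_a (k * p * p ^ i) @ pow_word Gen_t (int i)) @ [(Gen_t, True)])"
    by (rule pres_eq_append[OF Suc.IH pres_eq.refl])
  finally show ?case unfolding t by (simp add: algebra_simps)
qed

text \<open>
  Every element has the form \<open>t\<^sup>-\<^sup>m a\<^sup>k t\<^sup>l\<close> with \<open>m, l \<ge> 0\<close>, the affine map with translation part \<open>k / p\<^sup>m\<close>. Two such
  words for the same map become equal letter by letter after expanding both fractions to a
  common denominator.
\<close>

definition fraction_word :: "nat \<Rightarrow> int \<Rightarrow> nat \<Rightarrow> bs_gen word" where
  "fraction_word m k l = pow_word Gen_t (- int m) @ pow_word Gen_a k @ pow_word Gen_t (int l)"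

lemma fraction_word_expand:
  "pres_eq (bs_rel p) (fraction_word m k l) (fraction_word (m + j) (k * p ^ j) (l + j))"
proof -
  let ?t = "pow_word Gen_t" and ?a = "pow_word Gen_a"
  have "pres_eq (bs_rel p) (?a k) (?t (- int j) @ ?t (int j) @ ?a k)"
    using pres_eq_append[OF pres_eq.sym[OF pow_word_add[of _ Gen_t "- int j" "int j"]] pres_eq.refl] by simp
  also have "pres_eq (bs_rel p) \<dots> (?t (- int j) @ ?a (k * p ^ j) @ ?t (int j))"
    by (rule pres_eq_append[OF pres_eq.refl t_power_a_power])
  finally have "pres_eq (bs_rel p) (?t (- int m) @ ?a k @ ?t (int l))
      (?t (- int m) @ (?t (- int j) @ ?a (k * p ^ j) @ ?t (int j)) @ ?t (int l))"
    by (rule pres_eq_context)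
  also have "\<dots> = (?t (- int m) @ ?t (- int j)) @ ?a (k * p ^ j) @ (?t (int j) @ ?t (int l))"
    by simp
  also have "pres_eq (bs_rel p) \<dots> (?t (- int m + - int j) @ ?a (k * p ^ j) @ ?t (int j + int l))"
    by (intro pres_eq_append pow_word_add pres_eq.refl)
  finally show ?thesis by (simp add: fraction_word_def algebra_simps)
qed

lemma pres_eq_fraction_word: "\<exists>m k l. pres_eq (bs_rel p) w (fraction_word m k l)"
proof (induction w rule: rev_induct)
  case Nil
  then show ?case by (auto intro!: exI[of _ 0] pres_eq.refl simp: fraction_word_def)
next
  case (snoc x w)
  let ?t = "pow_word Gen_t" and ?a = "pow_word Gen_a"
  obtain m k l where w: "pres_eq (bs_rel p) w (fraction_word m k l)" using snoc by blast
  obtain g b where x: "x = (g, b)" by (cases x)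
  define i :: int where "i = (if b then 1 else - 1)"
  have xi: "[x] = pow_word g i" by (simp add: x i_def)
  show ?case
  proof (cases g)
    case Gen_a
    have "pres_eq (bs_rel p) (w @ [x]) (fraction_word m k l @ ?a i)"
      using pres_eq_append[OF w pres_eq.refl] xi Gen_a by simp
    also have "\<dots> = (?t (- int m) @ ?a k) @ ?t (int l) @ ?a i" by (simp add: fraction_word_def)
    also have "pres_eq (bs_rel p) \<dots> ((?t (- int m) @ ?a k) @ ?a (i * p ^ l) @ ?t (int l))"
      by (rule pres_eq_append[OF pres_eq.refl t_power_a_power])
    also have "\<dots> = ?t (- int m) @ (?a k @ ?a (i * p ^ l)) @ ?t (int l)" by simp
    also have "pres_eq (bs_rel p) \<dots> (fraction_word m (k + i * p ^ l) l)"
      unfolding fraction_word_def by (intro pres_eq_append pow_word_add pres_eq.refl)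
    finally show ?thesis by blast
  next
    case Gen_t
    have "pres_eq (bs_rel p) (w @ [x]) (fraction_word (m + 1) (k * p ^ 1) (l + 1) @ ?t i)"
      using pres_eq_append[OF pres_eq.trans[OF w fraction_word_expand[where j = 1]] pres_eq.refl] xi Gen_t
      by simp
    also have "\<dots> = (?t (- int (m + 1)) @ ?a (k * p ^ 1)) @ ?t (int (l + 1)) @ ?t i"
      by (simp add: fraction_word_def)
    also have "pres_eq (bs_rel p) \<dots> ((?t (- int (m + 1)) @ ?a (k * p ^ 1)) @ ?t (int (l + 1) + i))"
      by (intro pres_eq_append pow_word_add pres_eq.refl)
    also have "\<dots> = fraction_word (m + 1) (k * p ^ 1) (nat (int (l + 1) + i))"
      by (simp add: fraction_word_def i_def)
    finally show ?thesis by blast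
  qed
qed

lemma affine_pres_eq:
  assumes "p \<noteq> 0" "t_sum u = t_sum v" "shift p u = shift p v"
  shows "pres_eq (bs_rel p) u v"
proof -
  obtain m k l where u: "pres_eq (bs_rel p) u (fraction_word m k l)" using pres_eq_fraction_word by blast
  obtain m' k' l' where v: "pres_eq (bs_rel p) v (fraction_word m' k' l')" using pres_eq_fraction_word by blast
  have t: "t_sum (fraction_word m k l) = int l - int m"
    and s: "shift p (fraction_word m k l) = of_int k / of_int p ^ m" for m k l
    using assms(1) by (simp_all add: fraction_word_def shift_append power_int_minus field_simps)
  have "int l - int m = int l' - int m'"
    using pres_eq_affine[OF assms(1) u] pres_eq_affine[OF assms(1) v] assms(2) t by simp
  then have l: "l + m' = l' + m" by simp
  have "(of_int k :: rat) / of_int p ^ m = of_int k' / of_int p ^ m'"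
    using pres_eq_affine[OF assms(1) u] pres_eq_affine[OF assms(1) v] assms(3) s by simp
  then have "(of_int (k * p ^ m') :: rat) = of_int (k' * p ^ m)"
    using assms(1) by (simp add: field_simps)
  then have k: "k * p ^ m' = k' * p ^ m" unfolding of_int_eq_iff .
  have "pres_eq (bs_rel p) u (fraction_word (m + m') (k * p ^ m') (l + m'))"
    using u fraction_word_expand by (rule pres_eq.trans)
  moreover have "pres_eq (bs_rel p) v (fraction_word (m' + m) (k' * p ^ m) (l' + m))"
    using v fraction_word_expand by (rule pres_eq.trans)
  ultimately show ?thesis unfolding k l add.commute[of m' m] by (blast intro: pres_eq.intros)
qed

section \<open>The normal form as sparse base \<open>p\<close> expansions\<close>

text \<open>
  A pair \<open>(b, d)\<close> stands for the digit \<open>d\<close> at the place \<open>p\<^sup>b\<close>. The exponents \<open>\<alpha>\<close> of the normal form are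
  the negatives of the places, so that decreasing \<open>\<alpha>\<close> means increasing place.
\<close>

definition digits_word :: "int \<Rightarrow> (int \<times> int) list \<Rightarrow> bs_gen word" where
  "digits_word s ds = concat (map (\<lambda>(b, d). conj_word (s * d) (- b)) ds)"

definition sparse_digits :: "int \<Rightarrow> (int \<times> int) list \<Rightarrow> bool" where
  "sparse_digits p ds \<longleftrightarrow>
     sorted_wrt (\<lambda>x y. fst x < fst y) ds \<and> (\<forall>x\<in>set ds. 0 < snd x \<and> snd x < p)"

definition digits_value :: "int \<Rightarrow> (int \<times> int) list \<Rightarrow> rat" where
  "digits_value p ds = (\<Sum>(b, d)\<leftarrow>ds. of_int d * of_int p powi b)"

lemma digits_value_simps [simp]:
  "digits_value p [] = 0"
  "digits_value p (x # ds) = of_int (snd x) * of_int p powi fst x + digits_value p ds"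
  by (simp_all add: digits_value_def case_prod_beta)

lemma t_sum_digits_word [simp]: "t_sum (digits_word s ds) = 0"
  by (induction ds) (auto simp: digits_word_def conj_word_def)

lemma shift_digits_word: "p \<noteq> 0 \<Longrightarrow> shift p (digits_word s ds) = of_int s * digits_value p ds"
proof (induction ds)
  case (Cons x ds)
  have "digits_word s (x # ds) = conj_word (s * snd x) (- fst x) @ digits_word s ds"
    by (simp add: digits_word_def case_prod_beta)
  then show ?case using Cons by (simp add: conj_word_def shift_append power_int_minus field_simps)
qed (simp add: digits_word_def)

lemma digits_value_multiple:
  assumes "p \<noteq> 0" "\<forall>x\<in>set ds. b \<le> fst x"
  shows "\<exists>n :: int. digits_value p ds = of_int p powi b * of_int n"
  using assms(2)
proof (induction ds)
  case (Cons x ds)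
  then obtain n :: int where n: "digits_value p ds = of_int p powi b * of_int n" by auto
  obtain j where j: "fst x = b + int j" using Cons.prems by (metis list.set_intros(1) zle_iff_zadd)
  have "digits_value p (x # ds) = of_int p powi b * of_int (snd x * p ^ j + n)"
    using assms(1) by (simp add: n j power_int_add algebra_simps)
  then show ?case by blast
qed (auto intro: exI[of _ 0])

lemma digits_value_nonneg: "0 < p \<Longrightarrow> sparse_digits p ds \<Longrightarrow> 0 \<le> digits_value p ds"
  by (induction ds) (auto simp: sparse_digits_def)

lemma digits_value_pos:
  assumes "0 < p" "sparse_digits p ds" "ds \<noteq> []"
  shows "0 < digits_value p ds"
proof -
  obtain x es where ds: "ds = x # es" using assms(3) by (cases ds) auto
  have "sparse_digits p es" "0 < snd x" using assms(2) ds by (auto simp: sparse_digits_def)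
  then have "0 \<le> digits_value p es" "0 < (of_int (snd x) * of_int p powi fst x :: rat)"
    using digits_value_nonneg assms(1) by simp_all
  then show ?thesis by (simp add: ds)
qed

lemma digits_value_Cons:
  assumes "p \<noteq> 0" "sparse_digits p (x # ds)"
  obtains n :: int where "digits_value p (x # ds) = of_int p powi fst x * of_int (snd x + p * n)"
proof -
  have "\<forall>y\<in>set ds. fst x + 1 \<le> fst y" using assms(2) by (auto simp: sparse_digits_def)
  then obtain n :: int where "digits_value p ds = of_int p powi (fst x + 1) * of_int n"
    using digits_value_multiple[OF assms(1)] by blast
  then show thesis using assms(1) that[of n] by (simp add: power_int_add algebra_simps)
qed

text \<open>
  Dividing by the lowest power of \<open>p\<close> that occurs leaves an integer not divisible by \<open>p\<close>. Hence the
  lowest place is determined by the value, and then the lowest digit by its residue modulo \<open>p\<close>.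
\<close>

lemma digits_value_head_le:
  assumes "p \<ge> 2" "sparse_digits p (x # ds)" "sparse_digits p (y # es)"
    "digits_value p (x # ds) = digits_value p (y # es)"
  shows "fst y \<le> fst x"
proof (rule ccontr)
  assume "\<not> fst y \<le> fst x"
  then have "\<forall>z\<in>set (y # es). fst x + 1 \<le> fst z"
    using assms(3) by (fastforce simp: sparse_digits_def)
  then obtain n' :: int where n': "digits_value p (y # es) = of_int p powi (fst x + 1) * of_int n'"
    using digits_value_multiple[of p "y # es"] assms(1) by fastforce
  obtain n :: int where n: "digits_value p (x # ds) = of_int p powi fst x * of_int (snd x + p * n)"
    using digits_value_Cons[of p x ds] assms(1,2) by fastforce
  have "(of_int p :: rat) powi fst x * of_int (snd x + p * n) = of_int p powi fst x * of_int (p * n')"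
    using n n' assms(1,4) by (simp add: power_int_add mult.assoc)
  then have "(of_int (snd x + p * n) :: rat) = of_int (p * n')" using assms(1) by simp
  then have "snd x + p * n = p * n'" unfolding of_int_eq_iff .
  then have "p dvd snd x" by (metis dvd_add_left_iff dvd_triv_left)
  then show False using assms(2) zdvd_imp_le by (fastforce simp: sparse_digits_def)
qed

lemma sparse_digits_unique:
  assumes "p \<ge> 2" "sparse_digits p ds" "sparse_digits p es" "digits_value p ds = digits_value p es"
  shows "ds = es"
  using assms(2-)
proof (induction ds arbitrary: es)
  case Nil
  then show ?case using digits_value_pos[of p es] assms(1) by fastforce
next
  case (Cons x ds)
  have "0 < digits_value p (x # ds)" by (rule digits_value_pos) (use assms(1) Cons.prems in auto)
  then obtain y es' where es: "es = y # es'" using Cons.prems by (cases es) auto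
  have fst: "fst x = fst y"
    using digits_value_head_le[OF assms(1), of x ds y es'] digits_value_head_le[OF assms(1), of y es' x ds]
      Cons.prems es by simp
  obtain n :: int where n: "digits_value p (x # ds) = of_int p powi fst x * of_int (snd x + p * n)"
    using digits_value_Cons[of p x ds] assms(1) Cons.prems by fastforce
  obtain n' :: int where n': "digits_value p (y # es') = of_int p powi fst y * of_int (snd y + p * n')"
    using digits_value_Cons[of p y es'] assms(1) Cons.prems es by fastforce
  have "(of_int (snd x + p * n) :: rat) = of_int (snd y + p * n')"
    using n n' fst Cons.prems(3) es assms(1) by simp
  then have "snd x + p * n = snd y + p * n'" unfolding of_int_eq_iff .
  then have "(snd x + p * n) mod p = (snd y + p * n') mod p" by simp
  then have "snd x = snd y" using Cons.prems es by (simp add: sparse_digits_def)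
  then have xy: "x = y" using fst by (simp add: prod_eq_iff)
  have "digits_value p ds = digits_value p es'" using Cons.prems(3) xy es by simp
  then have "ds = es'"
    using Cons.IH[of es'] Cons.prems(1,2) es by (simp add: sparse_digits_def)
  then show ?case using xy es by simp
qed

lemma digits_word_functions:
  "digits_word s (map (\<lambda>j. (- \<alpha> j, \<eta> j)) js) = concat (map (\<lambda>j. conj_word (s * \<eta> j) (\<alpha> j)) js)"
  by (simp add: digits_word_def comp_def)

lemma sparse_digits_functions:
  "sparse_digits p (map (\<lambda>j. (- \<alpha> j, \<eta> j)) [0..<k + 1]) \<longleftrightarrow>
     (\<forall>j\<le>k. 0 < \<eta> j \<and> \<eta> j < p) \<and> (\<forall>j<k. \<alpha> j > \<alpha> (j + 1))"
proof -
  have tr: "transp (\<lambda>x y :: int \<times> int. fst x < fst y)" by (auto intro: transpI)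
  have nth: "map (\<lambda>j. (- \<alpha> j, \<eta> j)) [0..<k + 1] ! i = (- \<alpha> i, \<eta> i)" if "i \<le> k" for i
    using that by (simp del: upt_Suc)
  have "sorted_wrt (\<lambda>x y. fst x < fst y) (map (\<lambda>j. (- \<alpha> j, \<eta> j)) [0..<k + 1]) \<longleftrightarrow>
      (\<forall>j<k. \<alpha> j > \<alpha> (j + 1))"
    unfolding sorted_wrt_iff_nth_Suc_transp[OF tr] using nth by (simp del: upt_Suc)
  moreover have "(\<forall>x\<in>set (map (\<lambda>j. (- \<alpha> j, \<eta> j)) [0..<k + 1]). 0 < snd x \<and> snd x < p) \<longleftrightarrow>
      (\<forall>j\<le>k. 0 < \<eta> j \<and> \<eta> j < p)"
    by (auto simp del: upt_Suc simp: less_Suc_eq_le)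
  ultimately show ?thesis unfolding sparse_digits_def by blast
qed

lemma bs_words_eq:
  "bs_words p = {digits_word s ds @ pow_word Gen_t i | s ds i. s \<in> {1, - 1} \<and> sparse_digits p ds}"
proof -
  define D where "D s = {concat (map (\<lambda>j. conj_word (s * \<eta> j) (\<alpha> j)) [0..<k+1]) @ pow_word Gen_t i | \<eta> \<alpha> k i.
        (\<forall>j\<le>k. 0 < \<eta> j \<and> \<eta> j < p) \<and> (\<forall>j<k. \<alpha> j > \<alpha> (j+1))}" for s
  have D: "D s = {digits_word s ds @ pow_word Gen_t i | ds i. ds \<noteq> [] \<and> sparse_digits p ds}" for s
  proof (intro equalityI subsetI)
    fix v assume "v \<in> D s"
    then obtain \<eta> \<alpha> k i where
      v: "v = concat (map (\<lambda>j. conj_word (s * \<eta> j) (\<alpha> j)) [0..<k+1]) @ pow_word Gen_t i"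
      and c: "(\<forall>j\<le>k. 0 < \<eta> j \<and> \<eta> j < p) \<and> (\<forall>j<k. \<alpha> j > \<alpha> (j+1))"
      unfolding D_def by blast
    let ?ds = "map (\<lambda>j. (- \<alpha> j, \<eta> j)) [0..<k+1]"
    have "v = digits_word s ?ds @ pow_word Gen_t i" by (simp only: v digits_word_functions)
    moreover have "sparse_digits p ?ds" using c sparse_digits_functions by blast
    moreover have "?ds \<noteq> []" by simp
    ultimately show "v \<in> {digits_word s ds @ pow_word Gen_t i | ds i. ds \<noteq> [] \<and> sparse_digits p ds}"
      by blast
  next
    fix v assume "v \<in> {digits_word s ds @ pow_word Gen_t i | ds i. ds \<noteq> [] \<and> sparse_digits p ds}"
    then obtain ds i where v: "v = digits_word s ds @ pow_word Gen_t i" "ds \<noteq> []" "sparse_digits p ds"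
      by blast
    define k \<eta> \<alpha> where "k = length ds - 1" and "\<eta> j = snd (ds ! j)" and "\<alpha> j = - fst (ds ! j)" for j
    have ds: "ds = map (\<lambda>j. (- \<alpha> j, \<eta> j)) [0..<k+1]"
      using v(2) by (intro nth_equalityI) (auto simp: k_def \<eta>_def \<alpha>_def simp del: upt_Suc)
    have c: "(\<forall>j\<le>k. 0 < \<eta> j \<and> \<eta> j < p) \<and> (\<forall>j<k. \<alpha> j > \<alpha> (j + 1))"
      using v(3) ds sparse_digits_functions by metis
    have "v = concat (map (\<lambda>j. conj_word (s * \<eta> j) (\<alpha> j)) [0..<k+1]) @ pow_word Gen_t i"
      unfolding v(1) by (subst ds) (simp only: digits_word_functions)
    then show "v \<in> D s" unfolding D_def using c by blast
  qed
  have e: "digits_word s [] = []" "sparse_digits p []" for s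
    by (simp_all add: digits_word_def sparse_digits_def)
  have "bs_words p = {pow_word Gen_t i | i. True} \<union> D 1 \<union> D (- 1)"
    by (simp add: bs_words_def D_def del: upt_Suc)
  also have "\<dots> = {digits_word s ds @ pow_word Gen_t i | s ds i. s \<in> {1, - 1} \<and> sparse_digits p ds}"
    unfolding D
  proof (intro equalityI subsetI)
    fix v assume "v \<in> {digits_word s ds @ pow_word Gen_t i | s ds i. s \<in> {1, - 1} \<and> sparse_digits p ds}"
    then obtain s ds i where "v = digits_word s ds @ pow_word Gen_t i" "s \<in> {1, - 1}" "sparse_digits p ds"
      by blast
    then show "v \<in> {pow_word Gen_t i | i. True}
        \<union> {digits_word 1 ds @ pow_word Gen_t i | ds i. ds \<noteq> [] \<and> sparse_digits p ds}
        \<union> {digits_word (- 1) ds @ pow_word Gen_t i | ds i. ds \<noteq> [] \<and> sparse_digits p ds}"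
      using e(1)[of s] by (cases "ds = []") auto
  next
    fix v assume "v \<in> {pow_word Gen_t i | i. True}
        \<union> {digits_word 1 ds @ pow_word Gen_t i | ds i. ds \<noteq> [] \<and> sparse_digits p ds}
        \<union> {digits_word (- 1) ds @ pow_word Gen_t i | ds i. ds \<noteq> [] \<and> sparse_digits p ds}"
    then consider i where "v = digits_word 1 [] @ pow_word Gen_t i"
      | s ds i where "v = digits_word s ds @ pow_word Gen_t i" "s \<in> {1, - 1}" "sparse_digits p ds"
      using e(1)[of 1] by auto
    then show "v \<in> {digits_word s ds @ pow_word Gen_t i | s ds i. s \<in> {1, - 1} \<and> sparse_digits p ds}"
      using e(2) by cases blast+
  qed
  finally show ?thesis .
qed

lemma bs_words_unique:
  assumes "p \<ge> 2" "u \<in> bs_words p" "v \<in> bs_words p" "t_sum u = t_sum v" "shift p u = shift p v"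
  shows "u = v"
proof -
  obtain s ds i where u: "u = digits_word s ds @ pow_word Gen_t i" "s \<in> {1, - 1}" "sparse_digits p ds"
    using assms(2) unfolding bs_words_eq by blast
  obtain s' ds' i' where v: "v = digits_word s' ds' @ pow_word Gen_t i'" "s' \<in> {1, - 1}" "sparse_digits p ds'"
    using assms(3) unfolding bs_words_eq by blast
  have i: "i = i'" using assms(4) u v by simp
  have eq: "of_int s * digits_value p ds = of_int s' * digits_value p ds'"
    using assms(1,5) u(1) v(1) by (simp add: shift_append shift_digits_word)
  have nonneg: "0 \<le> digits_value p ds" "0 \<le> digits_value p ds'"
    using digits_value_nonneg u(3) v(3) assms(1) by simp_all
  then have val: "digits_value p ds = digits_value p ds'" using eq u(2) v(2) by auto
  then have ds: "ds = ds'" using sparse_digits_unique[OF assms(1) u(3) v(3)] by simp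
  show ?thesis
  proof (cases "ds = []")
    case True
    then show ?thesis using u v i ds by (simp add: digits_word_def)
  next
    case False
    then have "0 < digits_value p ds" using digits_value_pos u(3) assms(1) by simp
    then have "s = s'" using eq u(2) v(2) val by auto
    then show ?thesis using u v i ds by simp
  qed
qed

text \<open>
  A function that puts every word into normal form without changing its affine map shows that all
  group elements are represented, and is the normal form map by uniqueness.
\<close>

theorem normal_formI:
  assumes p: "p \<ge> 2"
    and f: "\<And>w. f w \<in> bs_words p \<and> t_sum (f w) = t_sum w \<and> shift p (f w) = shift p w"
  shows "normal_form (BS1 p) (bs_letter p) (bs_words p)"
    and "normal_form_map (BS1 p) (bs_letter p) (bs_words p) w = f w"
proof -
  have eq_iff: "word_elt (BS1 p) (bs_letter p) u = word_elt (BS1 p) (bs_letter p) v \<longleftrightarrow>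
      t_sum u = t_sum v \<and> shift p u = shift p v" for u v
    unfolding word_elt_presented_group word_class_eq_iff
    using pres_eq_affine[of p u v] affine_pres_eq[of p u v] p by auto
  show "normal_form (BS1 p) (bs_letter p) (bs_words p)"
    unfolding normal_form_def bij_betw_def
  proof
    show "inj_on (word_elt (BS1 p) (bs_letter p)) (bs_words p)"
    proof (rule inj_onI)
      fix u v assume "u \<in> bs_words p" "v \<in> bs_words p"
        and "word_elt (BS1 p) (bs_letter p) u = word_elt (BS1 p) (bs_letter p) v"
      then show "u = v" using bs_words_unique[OF p, of u v] by (simp only: eq_iff)
    qed
    have img: "word_elt (BS1 p) (bs_letter p) w \<in> word_elt (BS1 p) (bs_letter p) ` bs_words p" for w
    proof (rule image_eqI)
      show "word_elt (BS1 p) (bs_letter p) w = word_elt (BS1 p) (bs_letter p) (f w)"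
        using f[of w] by (simp only: eq_iff)
    qed (use f[of w] in blast)
    have "carrier (BS1 p) = range (word_elt (BS1 p) (bs_letter p))"
      unfolding word_elt_presented_group by (simp add: presented_group_def)
    then show "word_elt (BS1 p) (bs_letter p) ` bs_words p = carrier (BS1 p)"
      using img by (simp only:) (rule equalityI, blast, rule image_subsetI, simp)
  qed
  show "normal_form_map (BS1 p) (bs_letter p) (bs_words p) w = f w"
    unfolding normal_form_map_def eq_iff
    using f[of w] bs_words_unique[OF p] by (intro the_equality) auto
qed

section \<open>Digits by carrying\<close>

text \<open>
  The place of the letter \<open>w ! i\<close> is the exponent of \<open>p\<close> in its contribution to the translation part,
  shifted by \<open>length w\<close> to be a natural number. Accordingly \<open>numer p w\<close> is the numerator of the
  translation part over the denominator \<open>p\<close> to the power \<open>length w\<close>.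
\<close>

definition place :: "bs_gen word \<Rightarrow> nat \<Rightarrow> nat" where
  "place w i = nat (int (length w) + t_sum (take i w))"

definition numer :: "int \<Rightarrow> bs_gen word \<Rightarrow> int" where
  "numer p w = (\<Sum>i<length w. a_exp (w ! i) * p ^ place w i)"

definition low_part :: "int \<Rightarrow> bs_gen word \<Rightarrow> nat \<Rightarrow> int" where
  "low_part p w b = (\<Sum>i<length w. if place w i < b then a_exp (w ! i) * p ^ place w i else 0)"

definition place_count :: "bs_gen word \<Rightarrow> nat \<Rightarrow> int" where
  "place_count w b = (\<Sum>i<length w. if place w i = b then a_exp (w ! i) else 0)"

text \<open>
  Floor division extends the usual carry to letters of both signs. The factor \<open>s\<close> is \<open>1\<close> or \<open>-1\<close> and
  serves to turn the numerator into its absolute value.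
\<close>

definition carry_to :: "int \<Rightarrow> bs_gen word \<Rightarrow> int \<Rightarrow> nat \<Rightarrow> int" where
  "carry_to p w s b = (s * low_part p w b) div p ^ b"

definition digit_at :: "int \<Rightarrow> bs_gen word \<Rightarrow> int \<Rightarrow> nat \<Rightarrow> int" where
  "digit_at p w s b = (s * numer p w) div p ^ b mod p"

lemma abs_t_sum_le: "\<bar>t_sum w\<bar> \<le> int (length w)"
proof (induction w)
  case (Cons x w)
  have "\<bar>t_exp x\<bar> \<le> 1" by (cases x rule: t_exp.cases) auto
  then show ?case using Cons by simp
qed simp

lemma abs_a_exp_le: "\<bar>a_exp x\<bar> \<le> 1"
  by (cases x rule: a_exp.cases) auto

lemma int_place: "i \<le> length w \<Longrightarrow> int (place w i) = int (length w) + t_sum (take i w)"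
  using abs_t_sum_le[of "take i w"] by (simp add: place_def min_def split: if_splits)

lemma place_le: "i \<le> length w \<Longrightarrow> place w i \<le> length w + i"
  using abs_t_sum_le[of "take i w"] by (simp add: place_def nat_le_iff)

lemma place_0: "place w 0 = length w"
  by (simp add: place_def)

lemma place_Suc: "i < length w \<Longrightarrow> int (place w (Suc i)) = int (place w i) + t_exp (w ! i)"
  by (simp add: int_place take_Suc_conv_app_nth)

lemma shift_snoc: "p \<noteq> 0 \<Longrightarrow> shift p (w @ [x]) = shift p w + of_int p powi t_sum w * of_int (a_exp x)"
  by (simp add: shift_append)

lemma shift_take:
  assumes "p \<noteq> 0" "k \<le> length w"
  shows "of_int p ^ length w * shift p (take k w) =
    of_int (\<Sum>i<k. a_exp (w ! i) * p ^ place w i)"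
  using assms(2)
proof (induction k)
  case (Suc k)
  have "(of_int p :: rat) ^ length w * of_int p powi t_sum (take k w) = of_int p powi int (place w k)"
    using assms(1) Suc.prems by (simp add: int_place power_int_add)
  then show ?case
    using Suc assms(1) by (simp add: take_Suc_conv_app_nth shift_snoc algebra_simps)
qed simp

lemma shift_numer: "p \<noteq> 0 \<Longrightarrow> of_int p ^ length w * shift p w = of_int (numer p w)"
  using shift_take[of p "length w" w] by (simp add: numer_def)

lemma low_part_Suc: "low_part p w (Suc b) = low_part p w b + place_count w b * p ^ b"
  unfolding low_part_def place_count_def sum_distrib_right sum.distrib[symmetric]
  by (intro sum.cong) (auto simp: less_Suc_eq)

lemma numer_low_part: "p ^ b dvd numer p w - low_part p w b"
  unfolding numer_def low_part_def sum_subtractf[symmetric]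
  by (intro dvd_sum) (auto simp: le_imp_power_dvd dvd_mult)

lemma abs_low_part_le:
  assumes "p \<ge> 1"
  shows "\<bar>low_part p w b\<bar> \<le> int (length w) * p ^ b"
proof -
  have "\<bar>if place w i < b then a_exp (w ! i) * p ^ place w i else 0\<bar> \<le> p ^ b" for i
  proof (cases "place w i < b")
    case True
    have "\<bar>a_exp (w ! i)\<bar> * p ^ place w i \<le> 1 * p ^ b"
      using assms True abs_a_exp_le by (intro mult_mono power_increasing) auto
    then show ?thesis using True assms by (simp add: abs_mult)
  qed (use assms in simp)
  then have "\<bar>low_part p w b\<bar> \<le> (\<Sum>i<length w. p ^ b)"
    unfolding low_part_def by (intro order.trans[OF sum_abs] sum_mono)
  then show ?thesis by simp
qed

lemma carry_to_0: "p \<ge> 1 \<Longrightarrow> carry_to p w s 0 = 0"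
  by (simp add: carry_to_def low_part_def)

lemma carry_to_Suc:
  assumes "p \<ge> 1"
  shows "carry_to p w s (Suc b) = (carry_to p w s b + s * place_count w b) div p"
proof -
  have "carry_to p w s (Suc b) = (s * low_part p w b + s * place_count w b * p ^ b) div p ^ b div p"
    unfolding carry_to_def low_part_Suc power_Suc2
    using assms by (simp add: zdiv_zmult2_eq distrib_left mult.assoc)
  then show ?thesis using assms by (simp add: carry_to_def add.commute)
qed

text \<open>
  Letters above the place \<open>b\<close> contribute multiples of \<open>p\<^sup>b\<^sup>+\<^sup>1\<close>, so the digit at \<open>b\<close> depends only on the
  carry into \<open>b\<close> and the count at \<open>b\<close>.
\<close>

lemma digit_at_carry:
  assumes "p \<ge> 1"
  shows "digit_at p w s b = (carry_to p w s b + s * place_count w b) mod p"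
proof -
  obtain k where k: "numer p w = low_part p w (Suc b) + p ^ Suc b * k"
    using numer_low_part[of p "Suc b" w] by (metis diff_add_cancel add.commute dvdE)
  have "s * numer p w = s * low_part p w b + (s * place_count w b + p * s * k) * p ^ b"
    by (simp add: k low_part_Suc algebra_simps)
  then have "(s * numer p w) div p ^ b = carry_to p w s b + s * place_count w b + p * (s * k)"
    using assms by (simp add: carry_to_def)
  then show ?thesis by (simp add: digit_at_def)
qed

lemma carry_to_bounds:
  assumes "p \<ge> 1" "s \<in> {1, - 1}"
  shows "- int (length w) \<le> carry_to p w s b \<and> carry_to p w s b \<le> int (length w)"
proof -
  have "\<bar>s * low_part p w b\<bar> \<le> int (length w) * p ^ b"
    using abs_low_part_le[OF assms(1)] assms(2) by (auto simp: abs_mult)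
  then have "- int (length w) * p ^ b \<le> s * low_part p w b" "s * low_part p w b \<le> int (length w) * p ^ b"
    by simp_all
  then have "(- int (length w) * p ^ b) div p ^ b \<le> carry_to p w s b"
    "carry_to p w s b \<le> (int (length w) * p ^ b) div p ^ b"
    unfolding carry_to_def using assms(1) by (intro zdiv_mono1; simp)+
  moreover have "(- int (length w) * p ^ b) div p ^ b = - int (length w)"
    "(int (length w) * p ^ b) div p ^ b = int (length w)"
    by (rule nonzero_mult_div_cancel_right, use assms(1) in simp)+
  ultimately show ?thesis by simp
qed

lemma low_part_top: "low_part p w (3 * length w) = numer p w"
proof -
  have "place w i < 3 * length w" if "i < length w" for i
    using place_le[of i w] that by simp
  then show ?thesis unfolding low_part_def numer_def by (intro sum.cong) auto
qed

text \<open>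
  The letters stand at places below \<open>2 n\<close>, so the numerator is at most \<open>n p\<^sup>2\<^sup>n\<close>, and \<open>n < p\<^sup>n\<close>.
\<close>

lemma abs_numer_less:
  assumes "p \<ge> 2"
  shows "\<bar>numer p w\<bar> < p ^ (3 * length w)"
proof (cases "w = []")
  case False
  define n where "n = length w"
  have "low_part p w (2 * n) = numer p w"
  proof -
    have "place w i < 2 * n" if "i < n" for i
      using place_le[of i w] that by (simp add: n_def)
    then show ?thesis unfolding low_part_def numer_def n_def by (intro sum.cong) auto
  qed
  then have "\<bar>numer p w\<bar> \<le> int n * p ^ (2 * n)"
    using abs_low_part_le[of p w "2 * n"] assms by (simp add: n_def)
  also have "int n < p ^ n"
    using of_nat_less_two_power[of n, where 'a = int] power_mono[of 2 p n] assms by linarith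
  then have "int n * p ^ (2 * n) < p ^ n * p ^ (2 * n)" using assms by simp
  also have "\<dots> = p ^ (3 * n)" by (simp add: power_add[symmetric])
  finally show ?thesis by (simp add: n_def)
qed (simp add: numer_def)

text \<open>As \<open>\<bar>numer p w\<bar>\<close> is smaller than the divisor, only the sign survives the floor division.\<close>

lemma carry_to_top:
  assumes "p \<ge> 2" "s \<in> {1, - 1}"
  shows "carry_to p w s (3 * length w) = (if s * numer p w < 0 then - 1 else 0)"
proof -
  let ?q = "p ^ (3 * length w)" and ?v = "s * numer p w"
  have v: "\<bar>?v\<bar> < ?q" using abs_numer_less[OF assms(1)] assms(2) by (auto simp: abs_mult)
  have "?v div ?q = - 1" if "?v < 0"
    using v that by (intro int_div_pos_eq[of _ _ _ "?v + ?q"]) auto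
  moreover have "?v div ?q = 0" if "\<not> ?v < 0"
    using v that by (intro div_pos_pos_trivial) auto
  ultimately show ?thesis by (simp add: carry_to_def low_part_top)
qed

definition expansion :: "int \<Rightarrow> bs_gen word \<Rightarrow> int \<Rightarrow> (int \<times> int) list" where
  "expansion p w s =
     map (\<lambda>b. (int b - int (length w), digit_at p w s b))
       (filter (\<lambda>b. digit_at p w s b \<noteq> 0) [0..<3 * length w])"

definition numer_sign :: "int \<Rightarrow> bs_gen word \<Rightarrow> int" where
  "numer_sign p w = (if numer p w < 0 then - 1 else 1)"

definition bs_normal_word :: "int \<Rightarrow> bs_gen word \<Rightarrow> bs_gen word" where
  "bs_normal_word p w =
     digits_word (numer_sign p w) (expansion p w (numer_sign p w)) @ pow_word Gen_t (t_sum w)"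

lemma sum_digits: "(\<Sum>b<k. x div p ^ b mod p * p ^ b) = x mod p ^ k" if "p > 0" for x p :: int
proof (induction k)
  case (Suc k)
  have "x mod p ^ Suc k = p ^ k * (x div p ^ k mod p) + x mod p ^ k"
    using that zmod_zmult2_eq[of p x "p ^ k"] by (simp add: mult.commute)
  then show ?case using Suc by simp
qed simp

lemma sparse_expansion:
  assumes "p \<ge> 2"
  shows "sparse_digits p (expansion p w s)"
proof -
  have "sorted_wrt (<) (filter (\<lambda>b. digit_at p w s b \<noteq> 0) [0..<3 * length w])"
    by (intro sorted_wrt_filter sorted_wrt_upt)
  moreover have "0 < digit_at p w s b \<and> digit_at p w s b < p" if "digit_at p w s b \<noteq> 0" for b
    using assms that by (simp add: digit_at_def order.not_eq_order_implies_strict)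
  ultimately show ?thesis
    by (auto simp: sparse_digits_def expansion_def sorted_wrt_map)
qed

lemma digits_value_map_filter:
  "digits_value p (map (\<lambda>b. (f b, d b)) (filter (\<lambda>b. d b \<noteq> 0) bs)) =
     (\<Sum>b\<leftarrow>bs. of_int (d b) * of_int p powi f b)"
  by (induction bs) auto

lemma expansion_value:
  assumes "p \<ge> 2"
  shows "of_int p ^ length w * digits_value p (expansion p w (numer_sign p w)) = of_int \<bar>numer p w\<bar>"
proof -
  let ?s = "numer_sign p w"
  have abs: "?s * numer p w = \<bar>numer p w\<bar>" by (simp add: numer_sign_def)
  have "of_int p ^ length w * digits_value p (expansion p w ?s) =
      (\<Sum>b<3 * length w. of_int (digit_at p w ?s b) * (of_int p ^ length w * of_int p powi (int b - int (length w))))"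
    unfolding expansion_def digits_value_map_filter interv_sum_list_conv_sum_set_nat
    by (simp add: sum_distrib_left atLeast0LessThan algebra_simps)
  also have "\<dots> = (\<Sum>b<3 * length w. of_int (digit_at p w ?s b) * of_int p ^ b)"
    using assms by (intro sum.cong) (simp_all add: power_int_diff)
  also have "\<dots> = of_int (\<Sum>b<3 * length w. \<bar>numer p w\<bar> div p ^ b mod p * p ^ b)"
    by (simp add: digit_at_def abs)
  also have "(\<Sum>b<3 * length w. \<bar>numer p w\<bar> div p ^ b mod p * p ^ b) = \<bar>numer p w\<bar>"
    using abs_numer_less[OF assms, of w] assms by (simp add: sum_digits)
  finally show ?thesis .
qed

text \<open>
  No digit is lost by stopping at \<open>3 n\<close> places, since the absolute value of the numerator is smaller
  than \<open>p\<^sup>3\<^sup>n\<close>; the sign restores the numerator itself.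
\<close>

theorem bs_normal_word:
  assumes "p \<ge> 2"
  shows "bs_normal_word p w \<in> bs_words p \<and> t_sum (bs_normal_word p w) = t_sum w \<and>
    shift p (bs_normal_word p w) = shift p w"
proof (intro conjI)
  let ?s = "numer_sign p w"
  have "?s \<in> {1, - 1}" by (simp add: numer_sign_def)
  then show "bs_normal_word p w \<in> bs_words p"
    unfolding bs_words_eq bs_normal_word_def using sparse_expansion[OF assms] by blast
  show "t_sum (bs_normal_word p w) = t_sum w" by (simp add: bs_normal_word_def)
  have "of_int p ^ length w * shift p (bs_normal_word p w) =
      of_int ?s * (of_int p ^ length w * digits_value p (expansion p w ?s))"
    using assms by (simp add: bs_normal_word_def shift_append shift_digits_word)
  also have "\<dots> = of_int ?s * of_int \<bar>numer p w\<bar>" by (simp only: expansion_value[OF assms])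
  also have "\<dots> = of_int (numer p w)" by (simp add: numer_sign_def)
  also have "\<dots> = of_int p ^ length w * shift p w" using shift_numer[of p w] assms by simp
  finally show "shift p (bs_normal_word p w) = shift p w" using assms by simp
qed

lemma wp_ipos:
  assumes "ipos s \<le> length w + 1 \<Longrightarrow> wp w l p Q s"
  shows "wp w l p Q s"
  unfolding wp_def
proof (intro allI impI)
  fix m assume m: "represents w l m s"
  then have "ipos s \<le> length w + 1" by (simp add: represents_def)
  then show "\<exists>m' s'. exec w (l + 2) p m m' \<and> represents w l m' s' \<and> Q s'"
    using assms m unfolding wp_def by blast
qed

lemma wp_stay:
  assumes "f (aux s, flags s) (input_at w (ipos s)) = ((a, g), Stay, z)"
    and "Q (s\<lparr>aux := a, flags := g, out := out s @ z\<rparr>)"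
  shows "wp w l (home f) Q s"
proof (rule wp_ipos)
  assume "ipos s \<le> length w + 1"
  then have "s\<lparr>aux := a, flags := g, ipos := min (length w + 1) (move_head Stay (ipos s)), out := out s @ z\<rparr>
      = s\<lparr>aux := a, flags := g, out := out s @ z\<rparr>"
    by (cases s) simp
  with assms(2) show ?thesis by (intro wp_home[where f = f and d = Stay, OF assms(1)]) simp
qed

definition idle :: "('f, 'v, 'x) cprog" where
  "idle = home (\<lambda>r _. (r, Stay, []))"

definition move :: "move \<Rightarrow> ('f, 'v, 'x) cprog" where
  "move d = home (\<lambda>r _. (r, d, []))"

definition emit :: "(nat \<times> 'f \<Rightarrow> 'x list) \<Rightarrow> ('f, 'v, 'x) cprog" where
  "emit z = home (\<lambda>r _. (r, Stay, z r))"

definition assign :: "(nat \<times> 'f \<Rightarrow> 'x input_symbol \<Rightarrow> nat \<times> 'f) \<Rightarrow> ('f, 'v, 'x) cprog" where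
  "assign f = home (\<lambda>r x. (f r x, Stay, []))"

lemma wp_move:
  assumes "Q (s\<lparr>ipos := min (length w + 1) (move_head d (ipos s))\<rparr>)"
  shows "wp w l (move d) Q s"
  unfolding move_def
proof (rule wp_home, rule HOL.refl)
  have "s\<lparr>aux := aux s, flags := flags s, ipos := i, out := out s @ []\<rparr> = s\<lparr>ipos := i\<rparr>" for i
    by (cases s) simp
  with assms show "Q (s\<lparr>aux := aux s, flags := flags s,
      ipos := min (length w + 1) (move_head d (ipos s)), out := out s @ []\<rparr>)"
    by (simp only:)
qed

lemma wp_idle:
  assumes "Q s"
  shows "wp w l idle Q s"
  unfolding idle_def
proof (rule wp_stay, rule HOL.refl)
  have "s\<lparr>aux := aux s, flags := flags s, out := out s @ []\<rparr> = s"
    by (cases s) simp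
  with assms show "Q (s\<lparr>aux := aux s, flags := flags s, out := out s @ []\<rparr>)"
    by (simp only:)
qed

lemma wp_emit:
  assumes "Q (s\<lparr>out := out s @ z (aux s, flags s)\<rparr>)"
  shows "wp w l (emit z) Q s"
  unfolding emit_def
proof (rule wp_stay, rule HOL.refl)
  have "s\<lparr>aux := aux s, flags := flags s, out := y\<rparr> = s\<lparr>out := y\<rparr>" for y
    by (cases s) simp
  with assms show "Q (s\<lparr>aux := aux s, flags := flags s, out := out s @ z (aux s, flags s)\<rparr>)"
    by (simp only:)
qed

lemma wp_assign:
  assumes "f (aux s, flags s) (input_at w (ipos s)) = (a, g)" "Q (s\<lparr>aux := a, flags := g\<rparr>)"
  shows "wp w l (assign f) Q s"
  unfolding assign_def
proof (rule wp_stay)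
  show "(f (aux s, flags s) (input_at w (ipos s)), Stay, []) = ((a, g), Stay, [])"
    using assms(1) by simp
  have "s\<lparr>aux := a, flags := g, out := out s @ []\<rparr> = s\<lparr>aux := a, flags := g\<rparr>"
    by (cases s) simp
  with assms(2) show "Q (s\<lparr>aux := a, flags := g, out := out s @ []\<rparr>)"
    by (simp only:)
qed

lemma preserves_home:
  "preserves R (move d)" "preserves R idle" "preserves R (emit z)"
  "(\<forall>r\<in>R. \<forall>x. f r x \<in> R) \<Longrightarrow> preserves R (assign f)"
  by (auto simp: move_def idle_def emit_def assign_def home_def split: prod.split)

lemma preserves_while_differ:
  fixes q :: "('f, 'v, 'x) cprog"
  assumes "preserves R (compare u v :: ('f, 'v, 'x) cprog)" "preserves R q"
  shows "preserves R (while_differ u v q)"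
  using assms
  by (simp add: while_differ_def)

lemma input_at_simps [simp]:
  "input_at w 0 = Left_End" "input_at w (Suc (length w)) = Right_End"
  "input_at w (Suc i) \<noteq> Left_End" "i < length w \<Longrightarrow> input_at w (Suc i) = Letter (w ! i)"
  by (auto simp: input_at_def)

section \<open>A counter program for the normal form\<close>

text \<open>
  \<open>Len\<close> and \<open>Top\<close> hold \<open>n\<close> and \<open>3 n\<close> for an input of length \<open>n\<close>. \<open>Place\<close> runs through the places, and \<open>Exp\<close>
  holds the place of the letter being read; both are shifted by \<open>n\<close> to stay nonnegative, and so is \<open>Carry\<close>.
  \<open>Tmp\<close> is moved towards \<open>Len\<close> while powers of \<open>t\<close> are printed. The flags in the register are a small number (a digit, or the number of
  increments still to be made) and the sign of the translation part.
\<close>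

datatype counter = Len | Top | Exp | Place | Carry | Tmp

instance counter :: finite
proof
  have "(UNIV :: counter set) = {Len, Top, Exp, Place, Carry, Tmp}" using counter.exhaust by auto
  then show "finite (UNIV :: counter set)" by (metis finite.emptyI finite.insertI)
qed

type_synonym bs_prog = "(nat \<times> bool, counter, bs_gen letter) cprog"
type_synonym bs_state = "(nat \<times> bool, counter, bs_gen letter) cstate"

definition rewind :: bs_prog where
  "rewind = While (\<lambda>_ x _. x \<noteq> Left_End) (move Move_Left) ;; move Move_Right"

definition measure_input :: bs_prog where
  "measure_input = rewind ;; While (\<lambda>_ x _. x \<noteq> Right_End)
     (inc Len ;; inc Top ;; inc Top ;; inc Top ;; move Move_Right)"

text \<open>
  The counter \<open>Carry\<close> holds \<open>n + c\<close> for the signed carry \<open>c\<close>. If every one of the \<open>n\<close> letters adds \<open>p - 1\<close>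
  beyond its signed contribution, a scan at a place with count \<open>m\<close> turns it into
  \<open>n + c + n (p - 1) + m = n p + (c + m)\<close>, and division by \<open>p\<close> yields the same remainder as for
  \<open>c + m\<close> and the quotient \<open>n + (c + m) div p\<close>, the next carry with the same offset. In this way
  signed arithmetic is done with natural numbers, and, as \<open>p \<ge> 2\<close>, with increments only.
\<close>

fun amount :: "nat \<Rightarrow> bool \<Rightarrow> bs_gen letter input_symbol \<Rightarrow> nat" where
  "amount P neg (Letter (Gen_a, b)) = (if b = neg then P - 2 else P)"
| "amount P neg _ = P - 1"

definition add_letter :: "nat \<Rightarrow> bs_prog" where
  "add_letter P =
     compare Exp Place ;;
     assign (\<lambda>(a, d, neg) x. (a, if a = 0 then amount P neg x else P - 1, neg)) ;;
     While (\<lambda>(_, d, _) _ _. d \<noteq> 0)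
       (inc Carry ;; assign (\<lambda>(a, d, neg) _. (a, d - 1, neg)))"

definition follow_t :: bs_prog where
  "follow_t =
     Cond (\<lambda>_ x _. x = Letter (Gen_t, True)) (inc Exp)
       (Cond (\<lambda>_ x _. x = Letter (Gen_t, False)) (dec Exp) idle)"

text \<open>
  One scan handles one place: it adds up the letters that stand at the place given by the counter.
  It leaves the place of the end of the input in \<open>Exp\<close>.
\<close>

definition scan :: "nat \<Rightarrow> bs_prog" where
  "scan P = copy Exp Len ;; rewind ;;
     While (\<lambda>_ x _. x \<noteq> Right_End) (add_letter P ;; follow_t ;; move Move_Right)"

text \<open>
  Because of the offset \<open>n\<close> the exponent to be printed is the signed difference of \<open>v\<close> and \<open>Len\<close>. A copy
  of \<open>v\<close> moves towards \<open>Len\<close>, one letter per step; the letters are inverted unless \<open>b\<close> holds.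
\<close>

definition emit_t :: "counter \<Rightarrow> bool \<Rightarrow> bs_prog" where
  "emit_t v b = copy Tmp v ;; while_differ Tmp Len
     (Cond (\<lambda>(a, _) _ _. a = 1)
       (emit (\<lambda>_. [(Gen_t, \<not> b)]) ;; inc Tmp)
       (emit (\<lambda>_. [(Gen_t, b)]) ;; dec Tmp))"

definition emit_digit :: bs_prog where
  "emit_digit = Cond (\<lambda>(_, d, _) _ _. d = 0) idle
     (emit_t Place True ;; emit (\<lambda>(_, d, neg). replicate d (Gen_a, \<not> neg)) ;; emit_t Place False)"

definition pass :: "nat \<Rightarrow> bs_prog \<Rightarrow> bs_prog" where
  "pass P q = clear Place ;; copy Carry Len ;; while_differ Place Top
     (scan P ;; divmod P Carry ;; assign (\<lambda>(a, _, neg) _. (a, a, neg)) ;; q ;; inc Place)"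

text \<open>
  After the silent pass the counter \<open>Carry\<close> differs from \<open>Len\<close> exactly if the translation part is
  negative. The last scan recomputes the exponent of \<open>t\<close>, which the printed word ends with.
\<close>

definition bs_program :: "nat \<Rightarrow> bs_prog" where
  "bs_program P =
     measure_input ;; pass P idle ;;
     compare Carry Len ;; assign (\<lambda>(a, d, _) _. (a, d, a \<noteq> 0)) ;;
     pass P emit_digit ;; scan P ;; emit_t Exp True"

lemma preserves_bs_program:
  assumes "P \<ge> 2"
  shows "preserves ({..P} \<times> {..P} \<times> UNIV) (bs_program P)"
proof -
  have "amount P neg x \<le> P" for neg x
    by (cases "(P, neg, x)" rule: amount.cases) auto
  then show ?thesis
    using assms
    by (auto simp: bs_program_def measure_input_def pass_def scan_def add_letter_def follow_t_def
        emit_digit_def emit_t_def rewind_def preserves_counter_ops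
        intro!: preserves_home preserves_while_differ)
qed

section \<open>Correctness of the program\<close>

definition sign_of :: "bool \<Rightarrow> int" where
  "sign_of neg = (if neg then - 1 else 1)"

lemma int_amount: "P \<ge> 2 \<Longrightarrow> int (amount P neg (Letter y)) = int P - 1 + sign_of neg * a_exp y"
  by (cases y rule: a_exp.cases) (auto simp: sign_of_def of_nat_diff)

lemma wp_rewind:
  assumes "Q (s\<lparr>ipos := 1\<rparr>)"
  shows "wp w l rewind Q s"
  unfolding rewind_def
proof (intro wp_Seq wp_While[where I = "\<lambda>k s'. s' = s\<lparr>ipos := ipos s - k\<rparr>" and n = "ipos s"])
  fix k s' assume k: "k < ipos s" "s' = s\<lparr>ipos := ipos s - k\<rparr>"
  then obtain i where i: "ipos s - k = Suc i" by (metis Suc_diff_Suc)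
  have "i = ipos s - Suc k" using i by simp
  show "input_at w (ipos s') \<noteq> Left_End \<and>
      wp w l (move Move_Left) (\<lambda>s'. s' = s\<lparr>ipos := ipos s - Suc k\<rparr>) s'"
  proof (rule conjI)
    show "wp w l (move Move_Left) (\<lambda>s'. s' = s\<lparr>ipos := ipos s - Suc k\<rparr>) s'"
      by (rule wp_ipos, rule wp_move) (use k i in simp)
  qed (simp add: k i)
next
  fix s' assume "s' = s\<lparr>ipos := ipos s - ipos s\<rparr>"
  then show "\<not> input_at w (ipos s') \<noteq> Left_End \<and> wp w l (move Move_Right) Q s'"
    using assms by (auto intro!: wp_move)
qed (cases s; simp)

lemma wp_measure_input:
  assumes "env s Len = 0" "env s Top = 0" "3 * length w < 2 ^ l"
    and Q: "\<And>s'. env s' Len = length w \<Longrightarrow> env s' Top = 3 * length w \<Longrightarrow> out s' = out s \<Longrightarrow>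
      flags s' = flags s \<Longrightarrow> Q s'"
  shows "wp w l measure_input Q s"
  unfolding measure_input_def
  by (intro wp_Seq wp_rewind wp_While[where n = "length w" and
        I = "\<lambda>k s'. env s' Len = k \<and> env s' Top = 3 * k \<and> ipos s' = Suc k \<and> out s' = out s \<and>
          flags s' = flags s"] conjI wp_inc wp_move)
    (use assms in auto)

lemma wp_add_letter:
  assumes "P \<ge> 2" "env s Carry + P < 2 ^ l" "input_at w (ipos s) = Letter y"
    and Q: "\<And>s'. env s' = (env s)(Carry := env s Carry +
        (if env s Exp = env s Place then amount P (snd (flags s)) (Letter y) else P - 1)) \<Longrightarrow>
      snd (flags s') = snd (flags s) \<Longrightarrow> ipos s' = ipos s \<Longrightarrow> out s' = out s \<Longrightarrow> Q s'"
  shows "wp w l (add_letter P) Q s"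
proof -
  define neg where "neg = snd (flags s)"
  define d where "d = (if env s Exp = env s Place then amount P neg (Letter y) else P - 1)"
  have "d \<le> P" by (cases y rule: a_exp.cases) (auto simp: d_def)
  show ?thesis
    unfolding add_letter_def case_prod_beta
    apply (intro wp_Seq wp_compare wp_assign)
     apply (rule HOL.refl)
    apply (rule wp_While[where n = d and
        I = "\<lambda>k s'. flags s' = (d - k, neg) \<and> env s' = (env s)(Carry := env s Carry + k) \<and>
          ipos s' = ipos s \<and> out s' = out s"])
    subgoal using assms(3) by (auto simp: d_def neg_def)
    subgoal for k s'
      by (intro conjI wp_Seq wp_inc wp_assign, simp, use \<open>d \<le> P\<close> assms(2) in simp,
          rule HOL.refl, auto)
    subgoal for s' using Q[of s'] by (auto simp: d_def neg_def)
    done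
qed

lemma wp_follow_t:
  assumes "input_at w (ipos s) = Letter y" "0 \<le> int (env s Exp) + t_exp y" "env s Exp + 1 < 2 ^ l"
    and Q: "\<And>s'. env s' = (env s)(Exp := nat (int (env s Exp) + t_exp y)) \<Longrightarrow>
      flags s' = flags s \<Longrightarrow> ipos s' = ipos s \<Longrightarrow> out s' = out s \<Longrightarrow> Q s'"
  shows "wp w l follow_t Q s"
proof -
  consider b where "y = (Gen_a, b)" | "y = (Gen_t, True)" | "y = (Gen_t, False)"
    by (cases y rule: a_exp.cases) auto
  then show ?thesis
    unfolding follow_t_def
    by cases (use assms in \<open>auto intro!: wp_Cond wp_idle wp_inc wp_dec Q
      simp: nat_add_distrib nat_diff_distrib\<close>)
qed

text \<open>
  The bounds say that the counters fit on the tape: each letter adds at most \<open>P\<close> to \<open>Carry\<close>, and no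
  place exceeds \<open>2 n\<close>.
\<close>

lemma wp_scan:
  fixes s :: bs_state and w :: "bs_gen word"
  assumes P: "P \<ge> 2" and len: "env s Len = length w"
    and bounds: "env s Carry + length w * P < 2 ^ l" "2 * length w < 2 ^ l"
    and Q: "\<And>s'. env s' Len = length w \<Longrightarrow> env s' Top = env s Top \<Longrightarrow> env s' Place = env s Place \<Longrightarrow>
      int (env s' Exp) = int (length w) + t_sum w \<Longrightarrow>
      int (env s' Carry) = int (env s Carry) + int (length w) * (int P - 1) +
        sign_of (snd (flags s)) * place_count w (env s Place) \<Longrightarrow>
      snd (flags s') = snd (flags s) \<Longrightarrow> out s' = out s \<Longrightarrow> Q s'"
  shows "wp w l (scan P) Q s"
proof -
  let ?n = "length w"
  define b neg where "b = env s Place" and "neg = snd (flags s)"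
  define amt where
    "amt i = (if place w i = b then amount P neg (Letter (w ! i)) else P - 1)" for i
  have amt_le: "amt i \<le> P" for i
    by (cases "w ! i" rule: a_exp.cases) (auto simp: amt_def)
  have sum_le: "(\<Sum>i<k. amt i) \<le> k * P" for k
    using sum_bounded_above[of "{..<k}" amt P] amt_le by simp
  define I :: "nat \<Rightarrow> bs_state \<Rightarrow> bool" where
    "I k s' \<longleftrightarrow> env s' Len = ?n \<and> env s' Top = env s Top \<and> env s' Place = b \<and>
      env s' Exp = place w k \<and> env s' Carry = env s Carry + (\<Sum>i<k. amt i) \<and>
      snd (flags s') = neg \<and> out s' = out s \<and> ipos s' = Suc k" for k s'
  have body: "wp w l (add_letter P ;; follow_t ;; move Move_Right) (I (Suc k)) s'"
    if k: "k < ?n" and I: "I k s'" for k s'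
  proof -
    have input: "input_at w (ipos s') = Letter (w ! k)" using k I by (simp add: I_def)
    have "(\<Sum>i<k. amt i) + P \<le> ?n * P"
      using sum_le[of k] k mult_le_mono1[of "Suc k" ?n P] by simp
    then have carry: "env s' Carry + P < 2 ^ l" using I bounds(1) by (simp add: I_def)
    have "place w k + 1 \<le> 2 * ?n" using place_le[of k w] k by simp
    then have exp: "env s' Exp + 1 < 2 ^ l" using I bounds(2) by (simp add: I_def)
    have nonneg: "0 \<le> int (place w k) + t_exp (w ! k)"
      using place_Suc[OF k] by (metis of_nat_0_le_iff)
    have next_place: "nat (int (place w k) + t_exp (w ! k)) = place w (Suc k)"
      using place_Suc[OF k] by (metis nat_int)
    show ?thesis
      apply (rule wp_Seq, rule wp_add_letter[OF P carry input])
      apply (rule wp_Seq, rule wp_follow_t[of _ _ "w ! k"])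
      subgoal using input by simp
      subgoal using nonneg I by (simp add: I_def)
      subgoal using exp by simp
      subgoal by (rule wp_move) (use I k next_place in \<open>auto simp: I_def amt_def neg_def b_def\<close>)
      done
  qed
  have carry_sum: "int (\<Sum>i<?n. amt i) = int ?n * (int P - 1) + sign_of neg * place_count w b"
  proof -
    have "int (amt i) = (int P - 1) + sign_of neg * (if place w i = b then a_exp (w ! i) else 0)" for i
      using P int_amount[OF P, of neg "w ! i"] by (simp add: amt_def of_nat_diff del: amount.simps)
    then have "int (\<Sum>i<?n. amt i) =
        (\<Sum>i<?n. (int P - 1) + sign_of neg * (if place w i = b then a_exp (w ! i) else 0))"
      by simp
    also have "\<dots> = int ?n * (int P - 1) + sign_of neg * place_count w b"
      unfolding sum.distrib place_count_def sum_distrib_left by simp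
    finally show ?thesis .
  qed
  show ?thesis
    unfolding scan_def
  proof (intro wp_Seq wp_copy wp_rewind wp_While[where I = I and n = ?n])
    show "I 0 (s\<lparr>aux := 0, env := (env s)(Exp := env s Len), ipos := 1\<rparr>)"
      using len by (simp add: I_def place_0 b_def neg_def)
  next
    fix k s' assume "k < ?n" "I k s'"
    then show "input_at w (ipos s') \<noteq> Right_End \<and>
        wp w l (add_letter P ;; follow_t ;; move Move_Right) (I (Suc k)) s'"
      using body[of k s'] by (simp add: I_def)
  next
    fix s' assume I: "I ?n s'"
    have "Q s'"
      by (rule Q) (use I carry_sum int_place[of ?n w] in \<open>simp_all add: I_def b_def neg_def\<close>)
    then show "\<not> input_at w (ipos s') \<noteq> Right_End \<and> Q s'" using I by (simp add: I_def)
  qed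
qed

lemma wp_emit_t:
  fixes s :: bs_state and v :: counter and b :: bool
  assumes "v \<noteq> Tmp" "env s v < 2 ^ l" "env s Len < 2 ^ l"
  defines "i \<equiv> int (env s v) - int (env s Len)"
  assumes Q: "\<And>s'. (\<And>u. u \<noteq> Tmp \<Longrightarrow> env s' u = env s u) \<Longrightarrow> flags s' = flags s \<Longrightarrow>
      out s' = out s @ pow_word Gen_t (if b then i else - i) \<Longrightarrow> Q s'"
  shows "wp w l (emit_t v b) Q s"
proof -
  define x y where "x = env s v" and "y = env s Len"
  have word: "replicate (nat \<bar>int x - int y\<bar>) (Gen_t, (y \<le> x) = b) = pow_word Gen_t (if b then i else - i)"
    by (cases "x = y") (auto simp: pow_word_def i_def x_def y_def)
  define I :: "nat \<Rightarrow> bs_state \<Rightarrow> bool" where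
    "I k s' \<longleftrightarrow> (\<forall>u. u \<noteq> Tmp \<longrightarrow> env s' u = env s u) \<and> flags s' = flags s \<and>
      env s' Tmp = (if x < y then x + k else x - k) \<and>
      out s' = out s @ replicate k (Gen_t, (y \<le> x) = b)" for k s'
  show ?thesis
    unfolding emit_t_def case_prod_beta
  proof (intro wp_Seq wp_copy wp_while_differ[where I = I and n = "nat \<bar>int x - int y\<bar>"])
    show "I 0 (s\<lparr>aux := 0, env := (env s)(Tmp := env s v)\<rparr>)"
      by (simp add: I_def x_def)
  next
    fix k s' assume k: "k < nat \<bar>int x - int y\<bar>" and I: "I k s'"
    have len: "env s' Len = y" using I by (simp add: I_def y_def)
    have snoc: "replicate k c @ [c] = c # replicate k c" for c :: "bs_gen letter"
      by (simp add: replicate_append_same)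
    let ?body = "Cond (\<lambda>p _ _. fst p = 1) (emit (\<lambda>_. [(Gen_t, \<not> b)]) ;; inc Tmp)
        (emit (\<lambda>_. [(Gen_t, b)]) ;; dec Tmp)"
    show "env s' Tmp \<noteq> env s' Len \<and>
        wp w l ?body (I (Suc k)) (s'\<lparr>aux := if env s' Tmp < env s' Len then 1 else 2\<rparr>)"
    proof (cases "x < y")
      case True
      then have "env s' Tmp < y" "env s' Tmp = x + k" using I k by (auto simp: I_def)
      then show ?thesis
        using I True len assms(3)
        by (auto intro!: wp_Cond wp_Seq wp_emit wp_inc simp: I_def snoc y_def)
    next
      case False
      then have "y < env s' Tmp" "env s' Tmp = x - k" using I k by (auto simp: I_def)
      then show ?thesis
        using I False len
        by (auto intro!: wp_Cond wp_Seq wp_emit wp_dec simp: I_def snoc)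
    qed
  next
    fix s' assume I: "I (nat \<bar>int x - int y\<bar>) s'"
    then have "env s' Tmp = y" by (auto simp: I_def split: if_splits)
    moreover have "Q (s'\<lparr>aux := 0\<rparr>)"
      by (rule Q) (use I word in \<open>simp_all add: I_def\<close>)
    ultimately show "env s' Tmp = env s' Len \<and> Q (s'\<lparr>aux := 0\<rparr>)"
      using I by (simp add: I_def y_def)
  qed
qed

definition digit_output :: "nat \<Rightarrow> bool \<Rightarrow> nat \<Rightarrow> nat \<Rightarrow> bs_gen word" where
  "digit_output n neg d b =
     (if d = 0 then [] else conj_word (sign_of neg * int d) (- (int b - int n)))"

lemma wp_emit_digit:
  fixes s :: bs_state
  assumes "env s Place < 2 ^ l" "env s Len < 2 ^ l"
    and Q: "\<And>s'. (\<And>u. u \<noteq> Tmp \<Longrightarrow> env s' u = env s u) \<Longrightarrow> flags s' = flags s \<Longrightarrow>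
      out s' = out s @ digit_output (env s Len) (snd (flags s)) (fst (flags s)) (env s Place) \<Longrightarrow> Q s'"
  shows "wp w l emit_digit Q s"
proof -
  obtain d neg where fl: "flags s = (d, neg)" by (cases "flags s")
  show ?thesis
    unfolding emit_digit_def case_prod_beta
  proof (rule wp_Cond)
    assume "fst (snd (aux s, flags s)) = 0"
    then show "wp w l idle Q s"
      by (intro wp_idle Q) (auto simp: digit_output_def)
  next
    assume nz: "fst (snd (aux s, flags s)) \<noteq> 0"
    have a: "replicate d (Gen_a, \<not> neg) = pow_word Gen_a (sign_of neg * int d)"
      using nz fl by (auto simp: pow_word_def sign_of_def)
    show "wp w l (emit_t Place True ;; emit (\<lambda>p. replicate (fst (snd p)) (Gen_a, \<not> snd (snd p))) ;;
        emit_t Place False) Q s"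
      apply (rule wp_Seq, rule wp_emit_t)
      subgoal by simp
      subgoal using assms(1) .
      subgoal using assms(2) .
      apply (rule wp_Seq, rule wp_emit, rule wp_emit_t)
      subgoal by simp
      subgoal using assms(1) by simp
      subgoal using assms(2) by simp
      subgoal by (rule Q) (use nz a fl in \<open>simp_all add: digit_output_def conj_word_def\<close>)
      done
  qed
qed

text \<open>
  The program \<open>q\<close> treats the digit found at each place; it is \<open>idle\<close> in the silent pass and \<open>emit_digit\<close>
  in the printing pass. It may change no counter but \<open>Tmp\<close>.
\<close>

lemma wp_pass:
  fixes s :: bs_state and w :: "bs_gen word" and p :: int
  assumes p: "p \<ge> 2" "P = nat p"
    and env: "env s Len = length w" "env s Top = 3 * length w"
    and bound: "(P + 3) * (length w + 1) < 2 ^ l"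
    and q: "\<And>s Q. env s Place < 2 ^ l \<Longrightarrow> env s Len = length w \<Longrightarrow> snd (flags s) = neg \<Longrightarrow>
      (\<And>s'. (\<And>u. u \<noteq> Tmp \<Longrightarrow> env s' u = env s u) \<Longrightarrow> flags s' = flags s \<Longrightarrow>
        out s' = out s @ o_digit (fst (flags s)) (env s Place) \<Longrightarrow> Q s') \<Longrightarrow> wp w l q Q s"
    and neg: "snd (flags s) = neg"
    and Q: "\<And>s'. env s' Len = length w \<Longrightarrow> env s' Top = 3 * length w \<Longrightarrow>
      int (env s' Carry) = int (length w) + carry_to p w (sign_of neg) (3 * length w) \<Longrightarrow>
      snd (flags s') = neg \<Longrightarrow>
      out s' = out s @ concat (map (\<lambda>b. o_digit (nat (digit_at p w (sign_of neg) b)) b) [0..<3 * length w]) \<Longrightarrow>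
      Q s'"
  shows "wp w l (pass P q) Q s"
proof -
  let ?n = "length w" and ?s = "sign_of neg"
  let ?body = "scan P ;; divmod P Carry ;; assign (\<lambda>(a, _, neg) _. (a, a, neg)) ;; q ;; inc Place"
  have P: "P \<ge> 2" "int P = p" using p by simp_all
  have "3 * ?n + 1 \<le> (P + 3) * (?n + 1)" "2 * ?n + ?n * P \<le> (P + 3) * (?n + 1)"
    by (simp_all add: algebra_simps)
  then have bounds: "3 * ?n + 1 < 2 ^ l" "2 * ?n + ?n * P < 2 ^ l" "2 * ?n < 2 ^ l" "?n < 2 ^ l"
    using bound by linarith+
  define I :: "nat \<Rightarrow> bs_state \<Rightarrow> bool" where
    "I b s' \<longleftrightarrow> env s' Len = ?n \<and> env s' Top = 3 * ?n \<and> env s' Place = b \<and>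
      int (env s' Carry) = int ?n + carry_to p w ?s b \<and> snd (flags s') = neg \<and>
      out s' = out s @ concat (map (\<lambda>b. o_digit (nat (digit_at p w ?s b)) b) [0..<b])" for b s'
  have sgn: "?s \<in> {1, - 1}" by (simp add: sign_of_def)
  have body: "wp w l ?body (I (Suc b)) s1" if b: "b < 3 * ?n" and inv: "I b s1" for b s1
  proof -
    define x where "x = carry_to p w ?s b + ?s * place_count w b"
    have "carry_to p w ?s b \<le> int ?n" using carry_to_bounds[OF _ sgn] p(1) by simp
    then have "int (env s1 Carry) \<le> int (2 * ?n)" using inv by (simp add: I_def)
    then have carry: "env s1 Carry + ?n * P < 2 ^ l" using bounds(2) by linarith
    show ?thesis
    proof (rule wp_Seq, rule wp_scan[OF P(1) _ carry bounds(3)])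
      show "env s1 Len = ?n" using inv by (simp add: I_def)
    next
      fix s2 :: bs_state
      assume s2: "env s2 Len = ?n" "env s2 Top = env s1 Top" "env s2 Place = env s1 Place"
        "int (env s2 Carry) = int (env s1 Carry) + int ?n * (int P - 1) +
          sign_of (snd (flags s1)) * place_count w (env s1 Place)"
        "snd (flags s2) = snd (flags s1)" "out s2 = out s1"
      have "int (env s2 Carry) = x + int ?n * p"
        using s2(4) inv P(2) by (simp add: I_def x_def algebra_simps)
      then have "int (env s2 Carry div P) = int ?n + x div p"
        "int (env s2 Carry mod P) = x mod p"
        using p(1) P(2) by (simp_all add: zdiv_int zmod_int)
      then have dm: "int (env s2 Carry div P) = int ?n + carry_to p w ?s (Suc b)"
        "env s2 Carry mod P = nat (digit_at p w ?s b)"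
        using carry_to_Suc[of p w ?s b] digit_at_carry[of p w ?s b] p(1) by (simp_all add: x_def)
      show "wp w l (divmod P Carry ;; assign (\<lambda>(a, _, neg) _. (a, a, neg)) ;; q ;; inc Place)
          (I (Suc b)) s2"
        unfolding case_prod_beta
        apply (rule wp_Seq, rule wp_divmod)
        subgoal using P(1) by simp
        apply (rule wp_Seq, rule wp_assign, rule HOL.refl)
        apply (rule wp_Seq, rule q)
        subgoal using s2 inv b bounds(1) by (simp add: I_def)
        subgoal using s2 by simp
        subgoal using s2 inv by (simp add: I_def)
        subgoal for s3
          by (rule wp_inc) (use s2 inv b bounds(1) dm in \<open>simp_all add: I_def\<close>)
        done
    qed
  qed
  show ?thesis
    unfolding pass_def
  proof (intro wp_Seq wp_clear wp_copy wp_while_differ[where I = I and n = "3 * ?n"])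
    show "I 0 (s\<lparr>aux := 0, env := (env s)(Place := 0), aux := 0,
        env := (env (s\<lparr>aux := 0, env := (env s)(Place := 0)\<rparr>))
          (Carry := env (s\<lparr>aux := 0, env := (env s)(Place := 0)\<rparr>) Len)\<rparr>)"
      using env neg p(1) by (simp add: I_def carry_to_0)
  next
    fix b s' assume b: "b < 3 * ?n" and inv: "I b s'"
    show "env s' Place \<noteq> env s' Top \<and>
        wp w l ?body (I (Suc b)) (s'\<lparr>aux := if env s' Place < env s' Top then 1 else 2\<rparr>)"
      using body[of b "s'\<lparr>aux := if env s' Place < env s' Top then 1 else 2\<rparr>"] b inv
      by (simp add: I_def)
  next
    fix s' assume inv: "I (3 * ?n) s'"
    then have "Q (s'\<lparr>aux := 0\<rparr>)" by (intro Q) (simp_all add: I_def)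
    then show "env s' Place = env s' Top \<and> Q (s'\<lparr>aux := 0\<rparr>)" using inv by (simp add: I_def)
  qed
qed

lemma concat_digit_output:
  assumes "p \<ge> 2"
  shows "concat (map (\<lambda>b. digit_output (length w) neg (nat (digit_at p w (sign_of neg) b)) b) [0..<3 * length w])
    = digits_word (sign_of neg) (expansion p w (sign_of neg))"
proof -
  have "0 \<le> digit_at p w (sign_of neg) b" for b
    using assms by (simp add: digit_at_def)
  then have eq: "digit_output (length w) neg (nat (digit_at p w (sign_of neg) b)) b =
      (if digit_at p w (sign_of neg) b = 0 then []
       else conj_word (sign_of neg * digit_at p w (sign_of neg) b) (- (int b - int (length w))))" for b
    by (simp add: digit_output_def nat_eq_iff)
  have "concat (map (\<lambda>b. digit_output (length w) neg (nat (digit_at p w (sign_of neg) b)) b) bs)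
      = digits_word (sign_of neg) (map (\<lambda>b. (int b - int (length w), digit_at p w (sign_of neg) b))
          (filter (\<lambda>b. digit_at p w (sign_of neg) b \<noteq> 0) bs))" for bs
    unfolding eq by (induction bs) (simp_all add: digits_word_def)
  then show ?thesis by (simp add: expansion_def)
qed

lemma wp_bs_program:
  fixes s :: bs_state and w :: "bs_gen word" and p :: int
  assumes p: "p \<ge> 2" "P = nat p"
    and init: "env s = (\<lambda>_. 0)" "snd (flags s) = False" "out s = []"
    and bound: "(P + 3) * (length w + 1) < 2 ^ l"
    and Q: "\<And>s'. out s' = bs_normal_word p w \<Longrightarrow> Q s'"
  shows "wp w l (bs_program P) Q s"
proof -
  let ?n = "length w"
  have P: "P \<ge> 2" using p by simp
  have "3 * ?n \<le> (P + 3) * (?n + 1)" "2 * ?n + ?n * P \<le> (P + 3) * (?n + 1)"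
    by (simp_all add: algebra_simps)
  then have bounds: "3 * ?n < 2 ^ l" "2 * ?n + ?n * P < 2 ^ l" "2 * ?n < 2 ^ l" "?n < 2 ^ l"
    using bound by linarith+
  define neg where "neg \<longleftrightarrow> numer p w < 0"
  have sgn: "sign_of neg = numer_sign p w" by (simp add: sign_of_def neg_def numer_sign_def)
  have print: "wp w l (pass P emit_digit ;; scan P ;; emit_t Exp True) Q s1"
    if s1: "env s1 Len = ?n" "env s1 Top = 3 * ?n" "snd (flags s1) = neg" "out s1 = []" for s1
  proof (rule wp_Seq, rule wp_pass[OF p s1(1,2) bound _ s1(3)])
    fix s2 :: bs_state and Q :: "bs_state \<Rightarrow> bool"
    assume "env s2 Place < 2 ^ l" "env s2 Len = ?n" "snd (flags s2) = neg"
      "\<And>s'. (\<And>u. u \<noteq> Tmp \<Longrightarrow> env s' u = env s2 u) \<Longrightarrow> flags s' = flags s2 \<Longrightarrow>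
        out s' = out s2 @ digit_output ?n neg (fst (flags s2)) (env s2 Place) \<Longrightarrow> Q s'"
    then show "wp w l emit_digit Q s2"
      using bounds(4) by (intro wp_emit_digit) simp_all
  next
    fix s2 :: bs_state
    assume s2: "env s2 Len = ?n" "env s2 Top = 3 * ?n"
      "int (env s2 Carry) = int ?n + carry_to p w (sign_of neg) (3 * ?n)" "snd (flags s2) = neg"
      "out s2 = out s1 @ concat (map (\<lambda>b. digit_output ?n neg (nat (digit_at p w (sign_of neg) b)) b) [0..<3 * ?n])"
    have out2: "out s2 = digits_word (numer_sign p w) (expansion p w (numer_sign p w))"
      using s2(5) s1(4) concat_digit_output[OF p(1), of w neg] by (simp add: sgn)
    have "carry_to p w (sign_of neg) (3 * ?n) \<le> int ?n"
      using carry_to_bounds[of p "sign_of neg" w] p(1) by (simp add: sign_of_def)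
    then have "env s2 Carry \<le> 2 * ?n" using s2(3) by linarith
    then have carry: "env s2 Carry + ?n * P < 2 ^ l" using bounds(2) by linarith
    show "wp w l (scan P ;; emit_t Exp True) Q s2"
    proof (rule wp_Seq, rule wp_scan[OF P s2(1) carry bounds(3)])
      fix s3 :: bs_state
      assume s3: "env s3 Len = ?n" "int (env s3 Exp) = int ?n + t_sum w" "out s3 = out s2"
      have "env s3 Exp \<le> 2 * ?n" using s3(2) abs_t_sum_le[of w] by linarith
      then have "env s3 Exp < 2 ^ l" using bounds(3) by linarith
      then show "wp w l (emit_t Exp True) Q s3"
        by (intro wp_emit_t Q)
          (use s3 bounds(4) in \<open>simp_all add: bs_normal_word_def out2\<close>)
    qed
  qed
  show ?thesis
    unfolding bs_program_def case_prod_beta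
  proof (rule wp_Seq, rule wp_measure_input)
    fix s1 :: bs_state
    assume s1: "env s1 Len = ?n" "env s1 Top = 3 * ?n" "out s1 = out s" "flags s1 = flags s"
    have neg0: "snd (flags s1) = False" using s1(4) init(2) by simp
    show "wp w l (pass P idle ;; compare Carry Len ;;
        assign (\<lambda>p _. (fst p, fst (snd p), fst p \<noteq> 0)) ;;
        pass P emit_digit ;; scan P ;; emit_t Exp True) Q s1"
    proof (rule wp_Seq, rule wp_pass[OF p s1(1,2) bound _ neg0, where o_digit = "\<lambda>_ _. []"])
      fix s2 :: bs_state and Q :: "bs_state \<Rightarrow> bool"
      assume "\<And>s'. (\<And>u. u \<noteq> Tmp \<Longrightarrow> env s' u = env s2 u) \<Longrightarrow> flags s' = flags s2 \<Longrightarrow>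
        out s' = out s2 @ [] \<Longrightarrow> Q s'"
      then show "wp w l idle Q s2" by (intro wp_idle) simp
    next
      fix s2 :: bs_state
      assume s2: "env s2 Len = ?n" "env s2 Top = 3 * ?n"
        "int (env s2 Carry) = int ?n + carry_to p w (sign_of False) (3 * ?n)"
        "snd (flags s2) = False"
        "out s2 = out s1 @ concat (map (\<lambda>b. []) [0..<3 * ?n])"
      have top: "carry_to p w (sign_of False) (3 * ?n) = (if numer p w < 0 then - 1 else 0)"
        using carry_to_top[OF p(1), of 1 w] by (simp add: sign_of_def)
      then have "env s2 Carry \<noteq> env s2 Len \<longleftrightarrow> neg"
        using s2(1,3) by (auto simp: neg_def split: if_splits)
      moreover have "out s2 = []" using s2(5) s1(3) init(3) by simp
      ultimately have after: "neg = (env s2 Carry \<noteq> env s2 Len)" "out s2 = []" by auto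
      show "wp w l (compare Carry Len ;; assign (\<lambda>p _. (fst p, fst (snd p), fst p \<noteq> 0)) ;;
          pass P emit_digit ;; scan P ;; emit_t Exp True) Q s2"
        by (rule wp_Seq, rule wp_compare, rule wp_Seq, rule wp_assign, rule HOL.refl,
            rule print) (use s2(1,2) after in auto)
    qed
  qed (use init bounds in auto)
qed

lemma power_of_2_bracket: "\<exists>j. 2 ^ j \<le> m \<and> m < 2 ^ Suc j" if "m \<ge> 1" for m :: nat
  using that
proof (induction m rule: nat_induct_at_least)
  case base
  show ?case by (intro exI[of _ 0]) simp
next
  case (Suc m)
  then obtain j where j: "2 ^ j \<le> m" "m < 2 ^ Suc j" by blast
  show ?case
  proof (cases "Suc m < 2 ^ Suc j")
    case True
    then show ?thesis using j by (intro exI[of _ j]) simp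
  next
    case False
    then show ?thesis using j by (intro exI[of _ "Suc j"]) simp
  qed
qed

theorem proposition42:
  fixes p :: int
  assumes "p \<ge> 2"
  shows "normal_form (BS1 p) (bs_letter p) (bs_words p) \<and>
    logspace_computable (normal_form_map (BS1 p) (bs_letter p) (bs_words p))"
proof
  show "normal_form (BS1 p) (bs_letter p) (bs_words p)"
    by (rule normal_formI(1)[OF assms bs_normal_word[OF assms]])
  define P where "P = nat p"
  have P: "P \<ge> 2" using assms by (simp add: P_def)
  let ?start = "\<lparr>state = (0, 0, False), input_pos = 0, work_tape = (\<lambda>_. Blank),
    work_pos = 0, out_tape = []\<rparr> :: (nat \<times> nat \<times> bool, counter sym, bs_gen letter) config"
  have "logspace_computable (bs_normal_word p)"
  proof (rule logspace_computable_program[where p = "idle ;; bs_program P" and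
        R = "{..P} \<times> {..P} \<times> UNIV" and b = Blank and C = "real P + 7"])
    show "preserves ({..P} \<times> {..P} \<times> UNIV) (idle ;; bs_program P)"
      using preserves_bs_program[OF P] by (simp add: preserves_home)
    fix w :: "bs_gen word"
    define m where "m = max 2 (length w)"
    obtain j where j: "2 ^ j \<le> m" "m < 2 ^ Suc j"
      using power_of_2_bracket[of m] unfolding m_def by fastforce
    \<comment> \<open>The counters stay below \<open>(P + 3) (n + 1)\<close>. Both factors are bounded by powers of two, the first
      crudely because \<open>P\<close> is constant.\<close>
    define l where "l = P + 3 + Suc j"
    have "P + 3 < 2 ^ (P + 3)" by (rule less_exp)
    moreover have "length w + 1 \<le> 2 ^ Suc j" using j(2) by (simp add: m_def)
    ultimately have bound: "(P + 3) * (length w + 1) < 2 ^ l"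
      unfolding l_def power_add by (intro mult_less_le_imp_less) auto
    define m0 :: "(nat \<times> nat \<times> bool, counter sym, bs_gen letter) config" where
      "m0 = cells_config 0 (0, False) 0 [] 0 []"
    define s0 :: bs_state where
      "s0 = \<lparr>aux = 0, flags = (0, False), env = (\<lambda>_. 0), ipos = 0, out = []\<rparr>"
    \<comment> \<open>The two extra squares are the mark and the blank square after the last cell.\<close>
    have init: "exec w (l + 2) idle ?start m0"
      unfolding idle_def home_def
      by (intro exec_Do_eq) (auto simp: m0_def cells_config_def act_def tape_def fun_eq_iff)
    have "represents w l m0 s0"
      by (auto simp: represents_def m0_def s0_def intro!: exI[of _ "[]"])
    moreover have "wp w l (bs_program P) (\<lambda>s'. out s' = bs_normal_word p w) s0"
      by (rule wp_bs_program[OF assms P_def]) (use bound in \<open>simp_all add: s0_def\<close>)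
    ultimately obtain m' s' where
      m': "exec w (l + 2) (bs_program P) m0 m'" "represents w l m' s'" "out s' = bs_normal_word p w"
      unfolding wp_def by blast
    have "work_pos m' < l + 2" "out_tape m' = bs_normal_word p w"
      using m'(2,3) by (auto simp: represents_def cells_config_def)
    moreover have "exec w (l + 2) (idle ;; bs_program P) ?start m'"
      by (rule exec_Seq[OF init m'(1)])
    moreover have "real (l + 2) \<le> (real P + 7) * log 2 (real m)"
    proof -
      have "real j \<le> log 2 (real m)"
        using j(1) by (simp add: le_log_iff powr_realpow m_def)
      moreover have "1 \<le> log 2 (real m)" by (simp add: le_log_iff m_def)
      then have "real P + 6 \<le> (real P + 6) * log 2 (real m)" by simp
      ultimately show ?thesis by (simp add: l_def algebra_simps)
    qed
    ultimately show "\<exists>B m. exec w B (idle ;; bs_program P) ?start m \<and> work_pos m < B \<and>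
        out_tape m = bs_normal_word p w \<and> real B \<le> (real P + 7) * log 2 (real (max 2 (length w)))"
      unfolding m_def by blast
  qed simp_all
  then show "logspace_computable (normal_form_map (BS1 p) (bs_letter p) (bs_words p))"
    using normal_formI(2)[OF assms bs_normal_word[OF assms]] by presburger
qed

end
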